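(* Let $A$ and $B$ be nontrivial groups with the unique root property, and suppose at least one of them has finite quotients of arbitrarily large prime order. Then the abstract commensurator $\mathrm{Comm}(A\ast B)$ of the free product $A\ast B$ is not finitely generated.
   Context: A group has the unique root property if for all $x,y$ in it and every positive integer $n$, $x^n=y^n$ implies $x=y$. The abstract commensurator $\mathrm{Comm}(G)$ of a group $G$ is the group of equivalence classes of isomorphisms between finite-index subgroups of $G$, two such isomorphisms being equivalent if they agree on some finite-index subgroup of $G$ on which both are defined; the product of $\alpha:G_1\to G_1'$ and $\beta:G_2\to G_2'$ is $\alpha\beta:\alpha^{-1}(G_1'\cap G_2)\to\beta(G_1'\cap G_2)$. *)

theory Defs
  imports "HOL-Algebra.Algebra" "HOL-Computational_Algebra.Primes"
begin

definition unique_roots :: "('a, 'c) monoid_scheme \<Rightarrow> bool" where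
  "unique_roots G \<longleftrightarrow>
     (\<forall>x\<in>carrier G. \<forall>y\<in>carrier G. \<forall>n::nat. n > 0 \<longrightarrow> x [^]\<^bsub>G\<^esub> n = y [^]\<^bsub>G\<^esub> n \<longrightarrow> x = y)"

definition nontrivial_group :: "('a, 'c) monoid_scheme \<Rightarrow> bool" where
  "nontrivial_group G \<longleftrightarrow> carrier G \<noteq> {\<one>\<^bsub>G\<^esub>}"

definition large_prime_quotients :: "('a, 'c) monoid_scheme \<Rightarrow> bool" where
  "large_prime_quotients G \<longleftrightarrow>
     (\<forall>N::nat. \<exists>p H. Factorial_Ring.prime p \<and> p > N \<and> H \<lhd> G \<and> order (G Mod H) = p)"

definition finitely_generated_group :: "('a, 'c) monoid_scheme \<Rightarrow> bool" where
  "finitely_generated_group G \<longleftrightarrow>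
     (\<exists>S. finite S \<and> S \<subseteq> carrier G \<and> generate G S = carrier G)"

definition fp_letter :: "('a, 'c) monoid_scheme \<Rightarrow> ('b, 'd) monoid_scheme \<Rightarrow> 'a + 'b \<Rightarrow> bool" where
  "fp_letter A B x = (case x of Inl a \<Rightarrow> a \<in> carrier A \<and> a \<noteq> \<one>\<^bsub>A\<^esub>
                              | Inr b \<Rightarrow> b \<in> carrier B \<and> b \<noteq> \<one>\<^bsub>B\<^esub>)"

fun fp_alternating :: "('a + 'b) list \<Rightarrow> bool" where
  "fp_alternating (x # y # w) = (isl x \<noteq> isl y \<and> fp_alternating (y # w))"
| "fp_alternating _ = True"

fun fp_push :: "('a, 'c) monoid_scheme \<Rightarrow> ('b, 'd) monoid_scheme \<Rightarrow> 'a + 'b \<Rightarrow> ('a + 'b) list \<Rightarrow> ('a + 'b) list" where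
  "fp_push A B (Inl a) (Inl a' # w) =
     (if a \<otimes>\<^bsub>A\<^esub> a' = \<one>\<^bsub>A\<^esub> then w else Inl (a \<otimes>\<^bsub>A\<^esub> a') # w)"
| "fp_push A B (Inr b) (Inr b' # w) =
     (if b \<otimes>\<^bsub>B\<^esub> b' = \<one>\<^bsub>B\<^esub> then w else Inr (b \<otimes>\<^bsub>B\<^esub> b') # w)"
| "fp_push A B x w = x # w"

definition free_product :: "('a, 'c) monoid_scheme \<Rightarrow> ('b, 'd) monoid_scheme \<Rightarrow> ('a + 'b) list monoid" where
  "free_product A B =
     \<lparr> carrier = {w. (\<forall>x\<in>set w. fp_letter A B x) \<and> fp_alternating w},
       monoid.mult = (\<lambda>u v. foldr (fp_push A B) u v),
       one = [] \<rparr>"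

definition fi_subgroup :: "('a, 'c) monoid_scheme \<Rightarrow> 'a set \<Rightarrow> bool" where
  "fi_subgroup G H \<longleftrightarrow> subgroup H G \<and> finite (rcosets\<^bsub>G\<^esub> H)"

definition partial_comms :: "('a, 'c) monoid_scheme \<Rightarrow> ('a set \<times> ('a \<Rightarrow> 'a)) set" where
  "partial_comms G = {(H, f). fi_subgroup G H \<and> fi_subgroup G (f ` H) \<and>
      f \<in> iso (G\<lparr>carrier := H\<rparr>) (G\<lparr>carrier := f ` H\<rparr>) \<and> f \<in> extensional H}"

definition comm_equiv :: "('a, 'c) monoid_scheme \<Rightarrow> ('a set \<times> ('a \<Rightarrow> 'a)) \<Rightarrow> ('a set \<times> ('a \<Rightarrow> 'a)) \<Rightarrow> bool" where
  "comm_equiv G \<alpha> \<beta> \<longleftrightarrow>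
     (\<exists>K. fi_subgroup G K \<and> K \<subseteq> fst \<alpha> \<inter> fst \<beta> \<and> (\<forall>x\<in>K. snd \<alpha> x = snd \<beta> x))"

definition comm_class :: "('a, 'c) monoid_scheme \<Rightarrow> ('a set \<times> ('a \<Rightarrow> 'a)) \<Rightarrow> ('a set \<times> ('a \<Rightarrow> 'a)) set" where
  "comm_class G \<alpha> = {\<beta> \<in> partial_comms G. comm_equiv G \<alpha> \<beta>}"

definition comm_compose :: "('a set \<times> ('a \<Rightarrow> 'a)) \<Rightarrow> ('a set \<times> ('a \<Rightarrow> 'a)) \<Rightarrow> ('a set \<times> ('a \<Rightarrow> 'a))" where
  "comm_compose \<alpha> \<beta> =
     (let D = {x \<in> fst \<alpha>. snd \<alpha> x \<in> fst \<beta>} in (D, restrict (snd \<beta> \<circ> snd \<alpha>) D))"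

definition Comm :: "('a, 'c) monoid_scheme \<Rightarrow> ('a set \<times> ('a \<Rightarrow> 'a)) set monoid" where
  "Comm G =
     \<lparr> carrier = comm_class G ` partial_comms G,
       monoid.mult = (\<lambda>U V. comm_class G (comm_compose (SOME a. a \<in> U) (SOME b. b \<in> V))),
       one = comm_class G (carrier G, restrict id (carrier G)) \<rparr>"

end

theory Submission
  imports Defs
begin

text \<open>Fix finitely many generators of \<open>Comm G\<close>, \<open>G = A * B\<close>. Every \<open>x \<in> G\<close> has a power \<open>x\<^sup>j\<close> in the
  domain of each generator with \<open>0 < j \<le> N\<close>; so for a prime \<open>p > N\<close> each class in \<open>Comm G\<close> has a
  representative whose domain contains, for every \<open>x\<close>, a power \<open>x\<^sup>m\<close> with \<open>p\<close> not dividing \<open>m\<close>.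

  Now let \<open>A\<^sub>0\<close> be normal in \<open>A\<close> of prime index \<open>p > N\<close>, \<open>a \<in> A - A\<^sub>0\<close>, \<open>1 \<noteq> b \<in> B\<close>, and let \<open>H\<close> be the
  preimage of \<open>A\<^sub>0\<close> under the retraction \<open>G \<rightarrow> A\<close>. Let \<open>\<phi>\<close> be the automorphism of
  \<open>H = A\<^sub>0 * B * aBa\<^sup>-\<^sup>1 * \<dots>\<close> that conjugates the factor \<open>aBa\<^sup>-\<^sup>1\<close> by \<open>b\<close> and fixes the other factors.
  If \<open>\<phi>\<close> agreed on a subgroup of finite index with some \<open>f : D \<rightarrow> D'\<close> as above, \<open>D\<close> would contain
  some \<open>d = a\<^sup>m\<close> in the coset \<open>A\<^sub>0a\<close>. Put \<open>e = f(d)\<close>. Comparing \<open>f(dxd\<^sup>-\<^sup>1)\<close> with \<open>e f(x) e\<^sup>-\<^sup>1\<close> on powers of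
  \<open>a\<close> and of \<open>b\<close>, and using that nontrivial elements of a factor have their centralizer in that
  factor, one finds first \<open>e \<in> A\<close>, then \<open>e\<^sup>-\<^sup>1da\<^sup>-\<^sup>1ba \<in> B\<close>, which is absurd.

  To avoid decomposing \<open>H\<close>, \<open>\<phi>\<close> is obtained as \<open>c 1\<close> for a cocycle \<open>c : G \<times> G \<rightarrow> G\<close>,
  \<open>c s (g h) = c s g \<cdot> c (s g) h\<close>, which may be prescribed freely on the two factors.\<close>

lemma (in group) inv_mult_cancel:
  assumes "x \<in> carrier G" "y \<in> carrier G"
  shows "inv x \<otimes> (x \<otimes> y) = y" "x \<otimes> (inv x \<otimes> y) = y"
  using assms by (simp_all add: m_assoc[symmetric])

section \<open>Finite-index subgroups\<close>

text \<open>A right coset is determined by the value of \<open>F\<close> at any of its elements, so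
  there are at most as many cosets as values of \<open>F\<close>.\<close>

lemma (in group) fi_subgroupI:
  assumes H: "subgroup H G" and fin: "finite (F ` carrier G)"
    and F: "\<And>x y. x \<in> carrier G \<Longrightarrow> y \<in> carrier G \<Longrightarrow> F x = F y \<Longrightarrow> x \<otimes> inv y \<in> H"
  shows "fi_subgroup G H"
proof -
  interpret H: subgroup H G by (rule H)
  have "rcosets H \<subseteq> (\<lambda>z. H #> inv_into (carrier G) F z) ` F ` carrier G"
  proof
    fix C assume "C \<in> rcosets H"
    then obtain x where x: "x \<in> carrier G" "C = H #> x" by (auto simp: RCOSETS_def)
    define y where "y = inv_into (carrier G) F (F x)"
    have y: "y \<in> carrier G" "F y = F x"
      unfolding y_def using x by (auto intro!: inv_into_into f_inv_into_f)
    have "x \<otimes> inv y \<in> H" using F x y by simp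
    moreover have "x = (x \<otimes> inv y) \<otimes> y" using x y by (simp add: m_assoc)
    ultimately have "x \<in> H #> y" unfolding r_coset_def by blast
    then have "H #> x = H #> y" using H repr_independence y(1) by auto
    then show "C \<in> (\<lambda>z. H #> inv_into (carrier G) F z) ` F ` carrier G"
      using x y_def by auto
  qed
  then have "finite (rcosets H)" using fin finite_surj by blast
  then show ?thesis using H by (simp add: fi_subgroup_def)
qed

lemma (in group) fi_subgroup_finite: "fi_subgroup G H \<Longrightarrow> finite ((\<lambda>x. H #> x) ` carrier G)"
  unfolding fi_subgroup_def RCOSETS_def by (simp add: UNION_singleton_eq_range)

lemma (in group) rcoset_eq_imp:
  assumes "subgroup H G" "x \<in> carrier G" "y \<in> carrier G" "H #> x = H #> y"
  shows "x \<otimes> inv y \<in> H"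
proof -
  interpret H: subgroup H G by fact
  have "x \<in> H #> y" using assms rcos_self by metis
  then obtain h where "h \<in> H" "x = h \<otimes> y" unfolding r_coset_def by auto
  then show ?thesis using assms by (simp add: m_assoc)
qed

text \<open>Label \<open>x\<close> by the coset of \<open>K\<close> that contains
  \<open>h x\<close>; equal labels put the image of \<open>x y^-1\<close> into
  \<open>K\<close>.\<close>

lemma fi_subgroup_vimage:
  assumes "group G" "group G'" and h: "h \<in> hom G G'" and K: "fi_subgroup G' K"
  shows "fi_subgroup G {x \<in> carrier G. h x \<in> K}"
proof -
  interpret G: group G by fact
  interpret G': group G' by fact
  interpret gh: group_hom G G' h using h by unfold_locales
  have sK: "subgroup K G'" using K by (simp add: fi_subgroup_def)
  interpret K: subgroup K G' by (rule sK)
  show ?thesis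
  proof (rule G.fi_subgroupI)
    show "subgroup {x \<in> carrier G. h x \<in> K} G"
      by (rule G.subgroupI) auto
    have "(\<lambda>x. K #>\<^bsub>G'\<^esub> h x) ` carrier G \<subseteq> (\<lambda>x. K #>\<^bsub>G'\<^esub> x) ` carrier G'" by auto
    then show "finite ((\<lambda>x. K #>\<^bsub>G'\<^esub> h x) ` carrier G)"
      using G'.fi_subgroup_finite[OF K] finite_subset by blast
  next
    fix x y assume "x \<in> carrier G" "y \<in> carrier G" "K #>\<^bsub>G'\<^esub> h x = K #>\<^bsub>G'\<^esub> h y"
    then show "x \<otimes>\<^bsub>G\<^esub> inv\<^bsub>G\<^esub> y \<in> {x \<in> carrier G. h x \<in> K}"
      using G'.rcoset_eq_imp[OF sK, of "h x" "h y"] by simp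
  qed
qed

text \<open>Let \<open>t x\<close> be a representative of \<open>H #> x\<close> that depends only on
  this coset. The coset of \<open>x\<close> modulo \<open>H\<close> together with the coset of
  \<open>x t(x)^-1\<close> modulo \<open>K\<close> determines the coset of \<open>x\<close> modulo
  \<open>K\<close>, because the common representative cancels in
  \<open>(x t^-1)(y t^-1)^-1\<close>.\<close>

lemma (in group) fi_subgroup_trans:
  assumes H: "fi_subgroup G H" and K: "fi_subgroup (G\<lparr>carrier := H\<rparr>) K"
  shows "fi_subgroup G K"
proof -
  have sH: "subgroup H G" and sK: "subgroup K (G\<lparr>carrier := H\<rparr>)"
    using H K by (simp_all add: fi_subgroup_def)
  interpret H: subgroup H G by (rule sH)
  interpret GH: group "G\<lparr>carrier := H\<rparr>" using H.subgroup_is_group is_group by blast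
  define t where "t x = inv_into (carrier G) (\<lambda>x. H #> x) (H #> x)" for x
  have t: "t x \<in> carrier G \<and> x \<otimes> inv (t x) \<in> H" if "x \<in> carrier G" for x
  proof -
    have "t x \<in> carrier G" "H #> t x = H #> x"
      unfolding t_def using that by (auto intro!: inv_into_into f_inv_into_f)
    then show ?thesis using rcoset_eq_imp[OF sH that] by auto
  qed
  let ?k = "\<lambda>y. K #>\<^bsub>G\<lparr>carrier := H\<rparr>\<^esub> y"
  show ?thesis
  proof (rule fi_subgroupI)
    show "subgroup K G" using incl_subgroup[OF sH sK] .
    have "(\<lambda>x. (H #> x, ?k (x \<otimes> inv (t x)))) ` carrier G
        \<subseteq> ((\<lambda>x. H #> x) ` carrier G) \<times> (?k ` H)"
      using t by auto
    moreover have "finite (?k ` H)" using GH.fi_subgroup_finite[OF K] by simp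
    ultimately show "finite ((\<lambda>x. (H #> x, ?k (x \<otimes> inv (t x)))) ` carrier G)"
      using fi_subgroup_finite[OF H] by (meson finite_SigmaI finite_subset)
  next
    fix x y assume xy: "x \<in> carrier G" "y \<in> carrier G"
      and eq: "(H #> x, ?k (x \<otimes> inv (t x))) = (H #> y, ?k (y \<otimes> inv (t y)))"
    have tt: "t y = t x" using eq by (simp add: t_def)
    have xh: "x \<otimes> inv (t x) \<in> H" "y \<otimes> inv (t x) \<in> H" using t xy tt by metis+
    have "(x \<otimes> inv (t x)) \<otimes> inv\<^bsub>G\<lparr>carrier := H\<rparr>\<^esub> (y \<otimes> inv (t x)) \<in> K"
      using GH.rcoset_eq_imp[OF sK, of "x \<otimes> inv (t x)" "y \<otimes> inv (t x)"] eq tt xh by simp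
    then have "(x \<otimes> inv (t x)) \<otimes> inv (y \<otimes> inv (t x)) \<in> K"
      using m_inv_consistent[OF sH xh(2)] by simp
    then show "x \<otimes> inv y \<in> K"
      using xy t by (simp add: inv_mult_group m_assoc inv_mult_cancel)
  qed
qed

lemma (in group) fi_subgroup_restrict:
  assumes H: "subgroup H G" and K: "fi_subgroup G K"
  shows "fi_subgroup (G\<lparr>carrier := H\<rparr>) (H \<inter> K)"
proof -
  have "(\<lambda>x. x) \<in> hom (G\<lparr>carrier := H\<rparr>) G"
    using subgroup.subset[OF H] by (auto simp: hom_def)
  from fi_subgroup_vimage[OF subgroup.subgroup_is_group[OF H is_group] is_group this K]
  show ?thesis by (simp add: Int_def)
qed

lemma (in group) fi_subgroup_Int:
  assumes "fi_subgroup G H" "fi_subgroup G K"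
  shows "fi_subgroup G (H \<inter> K)"
  using assms fi_subgroup_trans fi_subgroup_restrict fi_subgroup_def by metis

lemma (in group) fi_subgroup_carrier: "fi_subgroup G (carrier G)"
  by (rule fi_subgroupI[where F = "\<lambda>_. ()"]) (auto simp: subgroup_self)

text \<open>Pigeonhole: if \<open>n\<close> is the number of right cosets, two of the powers
  \<open>x^0, ..., x^n\<close> lie in the same coset, and their quotient is a power with exponent
  between 1 and \<open>n\<close>. The bound is the index, hence the same for all \<open>x\<close>;
  this uniformity is what allows a prime to be chosen beyond it.\<close>

lemma (in group) fi_subgroup_pow:
  assumes H: "fi_subgroup G H"
  shows "\<exists>N. \<forall>x \<in> carrier G. \<exists>j::nat. 0 < j \<and> j \<le> N \<and> x [^] j \<in> H"
proof (rule exI, rule ballI)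
  let ?C = "(\<lambda>x. H #> x) ` carrier G"
  fix x assume x: "x \<in> carrier G"
  let ?f = "\<lambda>i::nat. H #> (x [^] i)"
  have "?f ` {0..card ?C} \<subseteq> ?C" using x by auto
  then have "card (?f ` {0..card ?C}) \<le> card ?C"
    using card_mono fi_subgroup_finite[OF H] by blast
  then have "\<not> inj_on ?f {0..card ?C}" by (intro pigeonhole) simp
  then obtain i k where ik: "i \<le> card ?C" "k < i" "?f i = ?f k"
    unfolding inj_on_def by (metis atLeastAtMost_iff linorder_neqE_nat)
  have "x [^] i \<otimes> inv (x [^] k) \<in> H"
    using rcoset_eq_imp[of H "x [^] i" "x [^] k"] H x ik by (simp add: fi_subgroup_def)
  moreover have "x [^] i = x [^] (i - k) \<otimes> x [^] k" using x ik by (simp add: nat_pow_mult)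
  ultimately have "x [^] (i - k) \<in> H" using x by (simp add: m_assoc)
  then show "\<exists>j::nat. 0 < j \<and> j \<le> card ?C \<and> x [^] j \<in> H"
    using ik by (intro exI[of _ "i - k"]) auto
qed

section \<open>The commensurator group\<close>

context group
begin

lemma partial_commsI:
  assumes "fi_subgroup G H" "fi_subgroup G (f ` H)" "inj_on f H" "f \<in> extensional H"
    and "\<And>x y. x \<in> H \<Longrightarrow> y \<in> H \<Longrightarrow> f (x \<otimes> y) = f x \<otimes> f y"
  shows "(H, f) \<in> partial_comms G"
  using assms by (auto simp: partial_comms_def iso_def hom_def bij_betw_def)

lemma partial_commsD:
  assumes "(H, f) \<in> partial_comms G"
  shows "fi_subgroup G H" "fi_subgroup G (f ` H)" "inj_on f H" "f \<in> extensional H"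
    "\<And>x y. x \<in> H \<Longrightarrow> y \<in> H \<Longrightarrow> f (x \<otimes> y) = f x \<otimes> f y"
    "subgroup H G" "H \<subseteq> carrier G" "\<And>x. x \<in> H \<Longrightarrow> f x \<in> carrier G"
    "f \<in> hom (G\<lparr>carrier := H\<rparr>) G" "group_hom (G\<lparr>carrier := H\<rparr>) G f"
proof -
  show a: "fi_subgroup G H" "fi_subgroup G (f ` H)" "inj_on f H" "f \<in> extensional H"
    using assms by (auto simp: partial_comms_def iso_def hom_def bij_betw_def)
  show m: "f (x \<otimes> y) = f x \<otimes> f y" if "x \<in> H" "y \<in> H" for x y
    using assms that by (auto simp: partial_comms_def iso_def hom_def)
  show b: "subgroup H G" "H \<subseteq> carrier G"
    using a subgroup.subset by (auto simp: fi_subgroup_def)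
  show c: "f x \<in> carrier G" if "x \<in> H" for x
    using a(2) that subgroup.subset by (fastforce simp: fi_subgroup_def)
  show d: "f \<in> hom (G\<lparr>carrier := H\<rparr>) G" using m c by (auto simp: hom_def)
  show "group_hom (G\<lparr>carrier := H\<rparr>) G f"
    using subgroup.subgroup_is_group[OF b(1) is_group] d is_group
    by (simp add: group_hom_def group_hom_axioms_def)
qed

lemma partial_comms_pow:
  assumes "(H, f) \<in> partial_comms G" "x \<in> H"
  shows "f (x [^] (n::nat)) = f x [^] n" "x [^] n \<in> H"
proof -
  interpret f: group_hom "G\<lparr>carrier := H\<rparr>" G f using partial_commsD(10)[OF assms(1)] .
  have "x [^] n = x [^]\<^bsub>G\<lparr>carrier := H\<rparr>\<^esub> n" by (rule nat_pow_consistent)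
  then show "f (x [^] n) = f x [^] n" "x [^] n \<in> H"
    using f.hom_nat_pow[of x n] f.G.nat_pow_closed[of x n] assms(2) by simp_all
qed

lemma partial_comms_vimage:
  assumes "(H, f) \<in> partial_comms G" "fi_subgroup G K"
  shows "fi_subgroup G {x \<in> H. f x \<in> K}"
proof -
  note D = partial_commsD[OF assms(1)]
  show ?thesis
    using fi_subgroup_vimage[OF subgroup.subgroup_is_group[OF D(6) is_group] is_group D(9) assms(2)]
    by (auto intro: fi_subgroup_trans[OF D(1)])
qed

section \<open>Inverses and composites of partial isomorphisms\<close>

definition comm_inverse :: "('a set \<times> ('a \<Rightarrow> 'a)) \<Rightarrow> ('a set \<times> ('a \<Rightarrow> 'a))" where
  "comm_inverse \<alpha> = (snd \<alpha> ` fst \<alpha>, restrict (inv_into (fst \<alpha>) (snd \<alpha>)) (snd \<alpha> ` fst \<alpha>))"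

lemma comm_inverse_closed:
  assumes "\<alpha> \<in> partial_comms G"
  shows "comm_inverse \<alpha> \<in> partial_comms G"
proof -
  obtain H f where \<alpha>: "\<alpha> = (H, f)" by fastforce
  note D = partial_commsD[OF assms[unfolded \<alpha>]]
  have inv: "inv_into H f (f x) = x" if "x \<in> H" for x using D(3) that by simp
  have im: "restrict (inv_into H f) (f ` H) ` f ` H = H" using inv by force
  have "(f ` H, restrict (inv_into H f) (f ` H)) \<in> partial_comms G"
  proof (rule partial_commsI)
    fix x y assume "x \<in> f ` H" "y \<in> f ` H"
    then obtain x' y' where *: "x' \<in> H" "x = f x'" "y' \<in> H" "y = f y'" by blast
    then have "x \<otimes> y = f (x' \<otimes> y')" "x' \<otimes> y' \<in> H"
      using D(5) subgroup.m_closed[OF D(6)] by auto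
    then show "restrict (inv_into H f) (f ` H) (x \<otimes> y)
        = restrict (inv_into H f) (f ` H) x \<otimes> restrict (inv_into H f) (f ` H) y"
      using * inv by simp
  next
    show "fi_subgroup G (restrict (inv_into H f) (f ` H) ` f ` H)" unfolding im by (rule D)
    show "fi_subgroup G (f ` H)" by (rule D)
    show "inj_on (restrict (inv_into H f) (f ` H)) (f ` H)" using inv by (auto simp: inj_on_def)
  qed auto
  then show ?thesis by (simp add: \<alpha> comm_inverse_def)
qed

text \<open>The image of \<open>H \<inter> K\<close> is the preimage of \<open>K\<close> under the
  inverse partial isomorphism.\<close>

lemma partial_comms_image:
  assumes "(H, f) \<in> partial_comms G" "fi_subgroup G K"
  shows "fi_subgroup G (f ` (H \<inter> K))"
proof -
  note D = partial_commsD[OF assms(1)]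
  have "fi_subgroup G {y \<in> f ` H. restrict (inv_into H f) (f ` H) y \<in> K}"
    by (rule partial_comms_vimage[OF
          comm_inverse_closed[OF assms(1), unfolded comm_inverse_def fst_conv snd_conv] assms(2)])
  moreover have "{y \<in> f ` H. restrict (inv_into H f) (f ` H) y \<in> K} = f ` (H \<inter> K)"
    using inv_into_f_f[OF D(3)] by force
  ultimately show ?thesis by simp
qed

lemma comm_compose_closed:
  assumes "\<alpha> \<in> partial_comms G" "\<beta> \<in> partial_comms G"
  shows "comm_compose \<alpha> \<beta> \<in> partial_comms G"
proof -
  obtain H f E g where ab: "\<alpha> = (H, f)" "\<beta> = (E, g)" by fastforce
  note D = partial_commsD[OF assms(1)[unfolded ab]]
  note D' = partial_commsD[OF assms(2)[unfolded ab]]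
  let ?D = "{x \<in> H. f x \<in> E}"
  have fi: "fi_subgroup G ?D"
    using partial_comms_vimage[OF assms(1)[unfolded ab] D'(1)] .
  have "(?D, restrict (g \<circ> f) ?D) \<in> partial_comms G"
  proof (rule partial_commsI)
    \<comment> \<open>In this form the range is the image under \<open>g\<close> of \<open>E\<close>
      cut down to a finite-index subgroup, so its index is finite by the image lemma.\<close>
    have "restrict (g \<circ> f) ?D ` ?D = g ` (E \<inter> f ` H)" by (auto simp: image_iff)
    then show "fi_subgroup G (restrict (g \<circ> f) ?D ` ?D)"
      using partial_comms_image[OF assms(2)[unfolded ab] D(2)] by simp
    show "inj_on (restrict (g \<circ> f) ?D) ?D"
      using D(3) D'(3) by (auto simp: inj_on_def)
  next
    fix x y assume *: "x \<in> ?D" "y \<in> ?D"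
    then have "x \<otimes> y \<in> ?D" using fi subgroup.m_closed[of ?D G] by (auto simp: fi_subgroup_def)
    with * show "restrict (g \<circ> f) ?D (x \<otimes> y) = restrict (g \<circ> f) ?D x \<otimes> restrict (g \<circ> f) ?D y"
      using D(5) D'(5) by auto
  qed (use fi in auto)
  then show ?thesis by (simp add: ab comm_compose_def Let_def)
qed

section \<open>Equivalence of partial isomorphisms and the group laws\<close>

lemma comm_equiv_refl: "\<alpha> \<in> partial_comms G \<Longrightarrow> comm_equiv G \<alpha> \<alpha>"
  unfolding comm_equiv_def using partial_commsD(1)[of "fst \<alpha>" "snd \<alpha>"] by auto

lemma comm_equiv_sym: "comm_equiv G \<alpha> \<beta> \<Longrightarrow> comm_equiv G \<beta> \<alpha>"
  unfolding comm_equiv_def by (metis Int_commute)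

lemma comm_equiv_trans:
  assumes "comm_equiv G \<alpha> \<beta>" "comm_equiv G \<beta> \<gamma>"
  shows "comm_equiv G \<alpha> \<gamma>"
proof -
  obtain K L where "fi_subgroup G K" "K \<subseteq> fst \<alpha> \<inter> fst \<beta>" "\<forall>x\<in>K. snd \<alpha> x = snd \<beta> x"
    "fi_subgroup G L" "L \<subseteq> fst \<beta> \<inter> fst \<gamma>" "\<forall>x\<in>L. snd \<beta> x = snd \<gamma> x"
    using assms unfolding comm_equiv_def by auto
  then show ?thesis unfolding comm_equiv_def
    by (intro exI[of _ "K \<inter> L"]) (auto simp: fi_subgroup_Int)
qed

lemma comm_class_eqI: "comm_equiv G \<alpha> \<beta> \<Longrightarrow> comm_class G \<alpha> = comm_class G \<beta>"
  unfolding comm_class_def using comm_equiv_sym comm_equiv_trans by blast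

lemma comm_class_self: "\<alpha> \<in> partial_comms G \<Longrightarrow> \<alpha> \<in> comm_class G \<alpha>"
  unfolding comm_class_def using comm_equiv_refl by blast

lemma comm_compose_cong:
  assumes "\<alpha> \<in> partial_comms G" "comm_equiv G \<alpha> \<alpha>'" "comm_equiv G \<beta> \<beta>'"
  shows "comm_equiv G (comm_compose \<alpha> \<beta>) (comm_compose \<alpha>' \<beta>')"
proof -
  obtain H f where a: "\<alpha> = (H, f)" by fastforce
  obtain K L where K: "fi_subgroup G K" "K \<subseteq> fst \<alpha> \<inter> fst \<alpha>'" "\<forall>x\<in>K. snd \<alpha> x = snd \<alpha>' x"
    and L: "fi_subgroup G L" "L \<subseteq> fst \<beta> \<inter> fst \<beta>'" "\<forall>x\<in>L. snd \<beta> x = snd \<beta>' x"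
    using assms unfolding comm_equiv_def by auto
  \<comment> \<open>On \<open>?M\<close> the first maps agree, and they lead to points where the
    second maps agree.\<close>
  let ?M = "K \<inter> {x \<in> H. f x \<in> L}"
  have "fi_subgroup G ?M"
    using fi_subgroup_Int[OF K(1) partial_comms_vimage[OF assms(1)[unfolded a] L(1)]] .
  moreover have M: "x \<in> fst \<alpha>' \<and> snd \<alpha>' x = f x \<and> f x \<in> fst \<beta> \<and> f x \<in> fst \<beta>'
      \<and> snd \<beta> (f x) = snd \<beta>' (f x)" if "x \<in> ?M" for x
    using that K L a by auto
  have "?M \<subseteq> fst (comm_compose \<alpha> \<beta>) \<inter> fst (comm_compose \<alpha>' \<beta>')"
    using M by (auto simp: comm_compose_def Let_def a)
  moreover have "\<forall>x\<in>?M. snd (comm_compose \<alpha> \<beta>) x = snd (comm_compose \<alpha>' \<beta>') x"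
    using M by (auto simp: comm_compose_def Let_def a)
  ultimately show ?thesis unfolding comm_equiv_def by blast
qed

text \<open>The product in \<open>Comm\<close> picks representatives by \<open>SOME\<close>; since
  composition respects equivalence, any other representatives give the same class.\<close>

lemma Comm_mult:
  assumes a: "\<alpha> \<in> partial_comms G" and b: "\<beta> \<in> partial_comms G"
  shows "comm_class G \<alpha> \<otimes>\<^bsub>Comm G\<^esub> comm_class G \<beta> = comm_class G (comm_compose \<alpha> \<beta>)"
proof -
  have some: "(SOME x. x \<in> comm_class G \<gamma>) \<in> comm_class G \<gamma>" if "\<gamma> \<in> partial_comms G" for \<gamma>
    using someI[of "\<lambda>x. x \<in> comm_class G \<gamma>"] comm_class_self[OF that] by blast
  have "comm_equiv G (comm_compose \<alpha> \<beta>)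
    (comm_compose (SOME x. x \<in> comm_class G \<alpha>) (SOME x. x \<in> comm_class G \<beta>))"
    using some[OF a] some[OF b] a by (intro comm_compose_cong) (auto simp: comm_class_def)
  then show ?thesis using comm_class_eqI by (simp add: Comm_def)
qed

lemma id_partial_comm: "(carrier G, restrict id (carrier G)) \<in> partial_comms G"
proof (rule partial_commsI)
  have "restrict id (carrier G) ` carrier G = carrier G" by auto
  then show "fi_subgroup G (restrict id (carrier G) ` carrier G)"
    using fi_subgroup_carrier by simp
qed (auto simp: fi_subgroup_carrier inj_on_def)

lemma Comm_l_inv:
  assumes a: "\<alpha> \<in> partial_comms G"
  shows "comm_class G (comm_inverse \<alpha>) \<otimes>\<^bsub>Comm G\<^esub> comm_class G \<alpha> = \<one>\<^bsub>Comm G\<^esub>"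
proof -
  obtain H f where \<alpha>: "\<alpha> = (H, f)" by fastforce
  note D = partial_commsD[OF a[unfolded \<alpha>]]
  \<comment> \<open>Composites apply the left factor first, so this one is the identity on the range
    of \<open>f\<close>, which has finite index.\<close>
  have "comm_equiv G (comm_compose (comm_inverse \<alpha>) \<alpha>) (carrier G, restrict id (carrier G))"
    unfolding comm_equiv_def
  proof (intro exI[of _ "f ` H"] conjI)
    show "fi_subgroup G (f ` H)" by (rule D)
  qed (use D(3,8) in \<open>auto simp: \<alpha> comm_inverse_def comm_compose_def Let_def\<close>)
  then have "comm_class G (comm_compose (comm_inverse \<alpha>) \<alpha>) = \<one>\<^bsub>Comm G\<^esub>"
    using comm_class_eqI by (simp add: Comm_def)
  then show ?thesis using Comm_mult[OF comm_inverse_closed[OF a] a] by simp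
qed

lemma Comm_carrier: "carrier (Comm G) = comm_class G ` partial_comms G"
  by (simp add: Comm_def)

lemma group_Comm: "group (Comm G)"
proof (rule groupI)
  fix x y z assume "x \<in> carrier (Comm G)" "y \<in> carrier (Comm G)" "z \<in> carrier (Comm G)"
  then obtain \<alpha> \<beta> \<gamma> where abc: "\<alpha> \<in> partial_comms G" "\<beta> \<in> partial_comms G" "\<gamma> \<in> partial_comms G"
    "x = comm_class G \<alpha>" "y = comm_class G \<beta>" "z = comm_class G \<gamma>" by (auto simp: Comm_carrier)
  \<comment> \<open>Associativity holds for the representatives themselves, as the domains and the
    default values outside them coincide too.\<close>
  have "comm_compose (comm_compose \<alpha> \<beta>) \<gamma> = comm_compose \<alpha> (comm_compose \<beta> \<gamma>)"
    by (auto simp: comm_compose_def Let_def fun_eq_iff)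
  then show "x \<otimes>\<^bsub>Comm G\<^esub> y \<otimes>\<^bsub>Comm G\<^esub> z = x \<otimes>\<^bsub>Comm G\<^esub> (y \<otimes>\<^bsub>Comm G\<^esub> z)"
    using abc by (simp add: Comm_mult comm_compose_closed)
next
  fix x y assume "x \<in> carrier (Comm G)" "y \<in> carrier (Comm G)"
  then show "x \<otimes>\<^bsub>Comm G\<^esub> y \<in> carrier (Comm G)"
    by (auto simp: Comm_carrier Comm_mult comm_compose_closed)
next
  show "\<one>\<^bsub>Comm G\<^esub> \<in> carrier (Comm G)" using id_partial_comm by (simp add: Comm_def)
next
  fix x assume "x \<in> carrier (Comm G)"
  then obtain \<alpha> where a: "\<alpha> \<in> partial_comms G" "x = comm_class G \<alpha>" by (auto simp: Comm_carrier)
  obtain H f where \<alpha>: "\<alpha> = (H, f)" by fastforce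
  note D = partial_commsD[OF a(1)[unfolded \<alpha>]]
  have "{x \<in> carrier G. restrict id (carrier G) x \<in> H} = H" using D(7) by auto
  \<comment> \<open>Outside \<open>H\<close> both sides are \<open>undefined\<close>, by
    extensionality of \<open>f\<close>; so the composite is \<open>\<alpha>\<close> itself and not
    merely equivalent to it.\<close>
  moreover have "restrict (f \<circ> restrict id (carrier G)) H = f"
    using D(4,7) by (auto simp: fun_eq_iff extensional_def)
  ultimately have "comm_compose (carrier G, restrict id (carrier G)) \<alpha> = \<alpha>"
    by (simp add: comm_compose_def Let_def \<alpha>)
  then show "\<one>\<^bsub>Comm G\<^esub> \<otimes>\<^bsub>Comm G\<^esub> x = x"
    using Comm_mult[OF id_partial_comm a(1)] a(2) by (simp add: Comm_def)
  show "\<exists>y\<in>carrier (Comm G). y \<otimes>\<^bsub>Comm G\<^esub> x = \<one>\<^bsub>Comm G\<^esub>"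
    using Comm_l_inv[OF a(1)] comm_inverse_closed[OF a(1)] a(2) by (auto simp: Comm_carrier)
qed

section \<open>Exponents prime to p as an invariant, and the criterion against finite
  generation\<close>

definition prime_to_rep :: "nat \<Rightarrow> ('a set \<times> ('a \<Rightarrow> 'a)) set \<Rightarrow> bool" where
  "prime_to_rep p U \<longleftrightarrow> (\<exists>\<alpha>\<in>partial_comms G. U = comm_class G \<alpha> \<and>
     (\<forall>x\<in>carrier G. \<exists>m::nat. \<not> p dvd m \<and> x [^] m \<in> fst \<alpha>))"

text \<open>The invariant asks for one good representative, since others may have smaller domains.
  If \<open>x^m\<close> is in the domain of \<open>\<alpha>\<close> with \<open>p\<close> not
  dividing \<open>m\<close>, then some \<open>j\<close> with \<open>0 < j < p\<close> puts
  \<open>f (x^m)^j = f (x^(m j))\<close> into the domain of \<open>\<beta>\<close>, and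
  \<open>p\<close> does not divide \<open>m j\<close> either.\<close>

lemma prime_to_rep_mult:
  assumes p: "Factorial_Ring.prime p" and V: "prime_to_rep p V" and b: "\<beta> \<in> partial_comms G"
    and small: "\<And>x. x \<in> carrier G \<Longrightarrow> \<exists>j::nat. 0 < j \<and> j < p \<and> x [^] j \<in> fst \<beta>"
  shows "prime_to_rep p (V \<otimes>\<^bsub>Comm G\<^esub> comm_class G \<beta>)"
proof -
  obtain \<alpha> where a: "\<alpha> \<in> partial_comms G" "V = comm_class G \<alpha>"
    and \<alpha>_pow: "\<And>x. x \<in> carrier G \<Longrightarrow> \<exists>m::nat. \<not> p dvd m \<and> x [^] m \<in> fst \<alpha>"
    using V unfolding prime_to_rep_def by blast
  obtain H f where \<alpha>: "\<alpha> = (H, f)" by fastforce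
  note D = partial_commsD[OF a(1)[unfolded \<alpha>]]
  note pow = partial_comms_pow[OF a(1)[unfolded \<alpha>]]
  have "\<exists>k::nat. \<not> p dvd k \<and> x [^] k \<in> fst (comm_compose \<alpha> \<beta>)" if x: "x \<in> carrier G" for x
  proof -
    obtain m :: nat where m: "\<not> p dvd m" "x [^] m \<in> H" using \<alpha>_pow[OF x] \<alpha> by auto
    obtain j :: nat where j: "0 < j" "j < p" "f (x [^] m) [^] j \<in> fst \<beta>"
      using small[of "f (x [^] m)"] D(8) m by blast
    have "\<not> p dvd m * j" using m j p by (auto simp: prime_dvd_mult_iff dest: dvd_imp_le)
    moreover have "x [^] (m * j) \<in> H" "f (x [^] (m * j)) \<in> fst \<beta>"
      using pow[OF m(2), of j] j(3) x by (simp_all add: nat_pow_pow)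
    ultimately show ?thesis by (auto simp: comm_compose_def Let_def \<alpha>)
  qed
  then show ?thesis unfolding prime_to_rep_def
    using a b Comm_mult comm_compose_closed by blast
qed

text \<open>The hypothesis supplies, for arbitrarily large primes \<open>p\<close>, a class that
  violates \<open>prime_to_rep p\<close>. Finite generation would give this property to every class
  as soon as \<open>p\<close> exceeds a bound depending on the generators.\<close>

theorem Comm_not_finitely_generated:
  assumes obstruction: "\<And>N. \<exists>p>N. Factorial_Ring.prime p \<and>
    (\<exists>\<alpha>\<in>partial_comms G. \<forall>\<beta>\<in>partial_comms G. comm_equiv G \<alpha> \<beta> \<longrightarrow>
       (\<exists>x\<in>carrier G. \<forall>m::nat. x [^] m \<in> fst \<beta> \<longrightarrow> p dvd m))"
  shows "\<not> finitely_generated_group (Comm G)"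
proof
  interpret C: group "Comm G" by (rule group_Comm)
  assume "finitely_generated_group (Comm G)"
  then obtain S where S: "finite S" "S \<subseteq> carrier (Comm G)" "generate (Comm G) S = carrier (Comm G)"
    unfolding finitely_generated_group_def by blast
  have "\<forall>U\<in>S. \<exists>\<alpha>. \<alpha> \<in> partial_comms G \<and> U = comm_class G \<alpha>"
    using S(2) unfolding Comm_carrier by blast
  then obtain rep where rep: "\<And>U. U \<in> S \<Longrightarrow> rep U \<in> partial_comms G \<and> U = comm_class G (rep U)"
    by metis
  \<comment> \<open>\<open>generate\<close> also admits inverses of generators, so \<open>R\<close>
    contains representatives of these as well.\<close>
  define R where "R = rep ` S \<union> comm_inverse ` rep ` S"
  have "comm_inverse (rep U) \<in> partial_comms G" if "U \<in> S" for U
    using rep[OF that] by (intro comm_inverse_closed) simp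
  then have R: "finite R" "R \<subseteq> partial_comms G"
    using S(1) rep unfolding R_def by (simp, blast)
  have "\<forall>\<beta>\<in>R. \<exists>N. \<forall>x\<in>carrier G. \<exists>j::nat. 0 < j \<and> j \<le> N \<and> x [^] j \<in> fst \<beta>"
  proof
    fix \<beta> assume "\<beta> \<in> R"
    then have "fi_subgroup G (fst \<beta>)" using R(2) partial_commsD(1)[of "fst \<beta>" "snd \<beta>"] by auto
    then show "\<exists>N. \<forall>x\<in>carrier G. \<exists>j::nat. 0 < j \<and> j \<le> N \<and> x [^] j \<in> fst \<beta>"
      by (rule fi_subgroup_pow)
  qed
  then obtain N where N: "\<And>\<beta> x. \<beta> \<in> R \<Longrightarrow> x \<in> carrier G \<Longrightarrow> \<exists>j::nat. 0 < j \<and> j \<le> N \<beta> \<and> x [^] j \<in> fst \<beta>"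
    by metis
  \<comment> \<open>The sum bounds every \<open>N \<beta>\<close> at once, so a single prime exceeds
    all exponents needed for members of \<open>R\<close>.\<close>
  obtain p \<alpha> where p: "p > sum N R" "Factorial_Ring.prime p" and \<alpha>: "\<alpha> \<in> partial_comms G"
    and ob: "\<And>\<beta>. \<beta> \<in> partial_comms G \<Longrightarrow> comm_equiv G \<alpha> \<beta> \<Longrightarrow>
       (\<exists>x\<in>carrier G. \<forall>m::nat. x [^] m \<in> fst \<beta> \<longrightarrow> p dvd m)"
    using obstruction[of "sum N R"] by blast
  have step: "prime_to_rep p (V \<otimes>\<^bsub>Comm G\<^esub> comm_class G \<beta>)"
    if "prime_to_rep p V" "\<beta> \<in> R" for V \<beta>
  proof (rule prime_to_rep_mult[OF p(2) that(1)])
    show "\<beta> \<in> partial_comms G" using R that by blast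
    fix x assume x: "x \<in> carrier G"
    have "N \<beta> \<le> sum N R" using that(2) R(1) by (simp add: member_le_sum)
    then show "\<exists>j::nat. 0 < j \<and> j < p \<and> x [^] j \<in> fst \<beta>"
      using N[OF that(2) x] p(1) by (meson le_less_trans)
  qed
  have carr: "V \<in> carrier (Comm G)" if "prime_to_rep p V" for V
    using that by (auto simp: prime_to_rep_def Comm_carrier)
  \<comment> \<open>Only right multiplication by classes from \<open>R\<close> is known to preserve
    the invariant. Quantifying over the left factor \<open>V\<close> reduces the product case to
    associativity.\<close>
  have gen: "\<forall>V. prime_to_rep p V \<longrightarrow> prime_to_rep p (V \<otimes>\<^bsub>Comm G\<^esub> U)" if "U \<in> generate (Comm G) S" for U
    using that
  proof induction
    case one
    then show ?case using carr by simp
  next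
    case (incl h)
    then have "rep h \<in> R" "h = comm_class G (rep h)" using rep by (auto simp: R_def)
    then show ?case using step[of _ "rep h"] by metis
  next
    case (inv h)
    have "inv\<^bsub>Comm G\<^esub> h = comm_class G (comm_inverse (rep h))"
    proof (rule C.inv_equality)
      show "comm_class G (comm_inverse (rep h)) \<otimes>\<^bsub>Comm G\<^esub> h = \<one>\<^bsub>Comm G\<^esub>"
        using Comm_l_inv rep[OF inv] by metis
      show "h \<in> carrier (Comm G)" using inv S(2) by blast
      show "comm_class G (comm_inverse (rep h)) \<in> carrier (Comm G)"
        using rep[OF inv] comm_inverse_closed[of "rep h"] by (auto simp: Comm_carrier)
    qed
    then show ?case using step[of _ "comm_inverse (rep h)"] inv by (auto simp: R_def)
  next
    case (eng h1 h2)
    then have "h1 \<in> carrier (Comm G)" "h2 \<in> carrier (Comm G)" using S(3) by auto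
    then show ?case using eng.IH carr by (simp add: C.m_assoc[symmetric])
  qed
  have one: "prime_to_rep p \<one>\<^bsub>Comm G\<^esub>"
    unfolding prime_to_rep_def
  proof (intro bexI[OF _ id_partial_comm] conjI ballI)
    show "\<one>\<^bsub>Comm G\<^esub> = comm_class G (carrier G, restrict id (carrier G))" by (simp add: Comm_def)
    fix x assume "x \<in> carrier G"
    then show "\<exists>m::nat. \<not> p dvd m \<and> x [^] m \<in> fst (carrier G, restrict id (carrier G))"
      using p(2) by (intro exI[of _ 1]) (auto dest: not_prime_unit)
  qed
  have "comm_class G \<alpha> \<in> generate (Comm G) S" using S(3) \<alpha> by (simp add: Comm_carrier)
  then have "prime_to_rep p (comm_class G \<alpha>)"
    using gen one S(3) C.l_one by metis
  then obtain \<beta> where \<beta>: "\<beta> \<in> partial_comms G" "comm_class G \<alpha> = comm_class G \<beta>"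
    "\<forall>x\<in>carrier G. \<exists>m::nat. \<not> p dvd m \<and> x [^] m \<in> fst \<beta>"
    unfolding prime_to_rep_def by blast
  have "comm_equiv G \<alpha> \<beta>" using comm_class_self[OF \<beta>(1)] \<beta>(2) by (auto simp: comm_class_def)
  then show False using ob \<beta> by blast
qed

end

section \<open>Conjugation and powers\<close>

lemma (in group) conj_commute:
  assumes "d \<in> carrier G" "e \<in> carrier G" "y \<in> carrier G"
    and "d \<otimes> y \<otimes> inv d = e \<otimes> y \<otimes> inv e"
  shows "(inv e \<otimes> d) \<otimes> y = y \<otimes> (inv e \<otimes> d)"
proof -
  have "inv e \<otimes> (d \<otimes> y \<otimes> inv d) \<otimes> d = inv e \<otimes> (e \<otimes> y \<otimes> inv e) \<otimes> d"
    using assms(4) by simp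
  then show ?thesis using assms(1-3) by (simp add: m_assoc inv_mult_cancel)
qed

lemma (in group) conj_pow:
  assumes "d \<in> carrier G" "x \<in> carrier G"
  shows "(d \<otimes> x \<otimes> inv d) [^] (n::nat) = d \<otimes> x [^] n \<otimes> inv d"
  using assms by (induction n) (simp_all add: m_assoc inv_mult_cancel)

lemma (in group) subgroup_pow_closed:
  assumes "subgroup H G" "x \<in> H"
  shows "x [^] (n::nat) \<in> H"
  using assms subgroup.one_closed subgroup.m_closed by (induction n) fastforce+

section \<open>Cocycles on internal free products\<close>

text \<open>Reading \<open>x\<close> in the state \<open>s\<close> outputs \<open>c s x\<close> and
  moves to the state \<open>s \<otimes> x\<close>; the law says that outputs along a product are
  multiplied. If the values do not depend on \<open>s\<close>, this is multiplicativity.\<close>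

definition cocycle_on :: "('a, 'c) monoid_scheme \<Rightarrow> 'a set \<Rightarrow> ('a \<Rightarrow> 'a \<Rightarrow> 'a) \<Rightarrow> bool" where
  "cocycle_on G P c \<longleftrightarrow> (\<forall>s\<in>carrier G. \<forall>x\<in>P. c s x \<in> carrier G \<and>
     (\<forall>y\<in>P. c s (x \<otimes>\<^bsub>G\<^esub> y) = c s x \<otimes>\<^bsub>G\<^esub> c (s \<otimes>\<^bsub>G\<^esub> x) y))"

lemma cocycle_onD:
  assumes "cocycle_on G P c" "s \<in> carrier G" "x \<in> P"
  shows "c s x \<in> carrier G"
    and "y \<in> P \<Longrightarrow> c s (x \<otimes>\<^bsub>G\<^esub> y) = c s x \<otimes>\<^bsub>G\<^esub> c (s \<otimes>\<^bsub>G\<^esub> x) y"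
  using assms unfolding cocycle_on_def by blast+

lemma (in group) cocycle_one:
  assumes "cocycle_on G P c" "subgroup P G" "s \<in> carrier G"
  shows "c s \<one> = \<one>"
proof -
  have 1: "\<one> \<in> P" using assms(2) by (rule subgroup.one_closed)
  have "c s \<one> = c s \<one> \<otimes> c s \<one>" using cocycle_onD(2)[OF assms(1,3) 1 1] assms(3) by simp
  then show ?thesis using cocycle_onD(1)[OF assms(1,3) 1] by simp
qed

lemma (in group) cocycle_inv:
  assumes c: "cocycle_on G (carrier G) c" and s: "s \<in> carrier G" and g: "g \<in> carrier G"
  shows "c s (inv g) = inv (c (s \<otimes> inv g) g)"
proof -
  have "c s (inv g \<otimes> g) = c s (inv g) \<otimes> c (s \<otimes> inv g) g"
    using g by (intro cocycle_onD(2)[OF c s]) auto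
  then have "c s (inv g) \<otimes> c (s \<otimes> inv g) g = \<one>"
    using cocycle_one[OF c subgroup_self s] g by simp
  then show ?thesis using cocycle_onD(1)[OF c] s g by (simp add: inv_equality)
qed

text \<open>The extension axiom is the universal property of \<open>P * Q\<close> for homomorphisms into the
  wreath product of \<open>G\<close> with the right regular representation of \<open>G\<close>.\<close>
locale internal_free_product = group G for G (structure) +
  fixes P Q
  assumes P: "subgroup P G" and Q: "subgroup Q G"
    and factor_induct [consumes 1, case_names one mult]:
      "g \<in> carrier G \<Longrightarrow> R \<one> \<Longrightarrow>
        (\<And>x g. x \<in> P \<union> Q \<Longrightarrow> g \<in> carrier G \<Longrightarrow> R g \<Longrightarrow> R (x \<otimes> g)) \<Longrightarrow> R g"
    and cocycle_extension: "cocycle_on G P L \<Longrightarrow> cocycle_on G Q M \<Longrightarrow>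
        \<exists>c. cocycle_on G (carrier G) c \<and>
          (\<forall>s\<in>carrier G. (\<forall>x\<in>P. c s x = L s x) \<and> (\<forall>x\<in>Q. c s x = M s x))"
    and centralizer_P: "x \<in> P \<Longrightarrow> x \<noteq> \<one> \<Longrightarrow> g \<in> carrier G \<Longrightarrow> g \<otimes> x = x \<otimes> g \<Longrightarrow> g \<in> P"
    and centralizer_Q: "x \<in> Q \<Longrightarrow> x \<noteq> \<one> \<Longrightarrow> g \<in> carrier G \<Longrightarrow> g \<otimes> x = x \<otimes> g \<Longrightarrow> g \<in> Q"
begin

text \<open>Symmetry serves twice: for the retraction onto \<open>Q\<close>, and when it is the
  second factor that has the large prime quotients.\<close>

lemma swap: "internal_free_product G Q P"
proof (intro internal_free_product.intro internal_free_product_axioms.intro)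
  fix L M :: "'a \<Rightarrow> 'a \<Rightarrow> 'a" assume "cocycle_on G Q L" "cocycle_on G P M"
  then show "\<exists>c. cocycle_on G (carrier G) c \<and>
          (\<forall>s\<in>carrier G. (\<forall>x\<in>Q. c s x = L s x) \<and> (\<forall>x\<in>P. c s x = M s x))"
    using cocycle_extension[of M L] by blast
next
  fix g and R :: "'a \<Rightarrow> bool"
  assume "g \<in> carrier G" "R \<one>" "\<And>x g. x \<in> Q \<union> P \<Longrightarrow> g \<in> carrier G \<Longrightarrow> R g \<Longrightarrow> R (x \<otimes> g)"
  then show "R g" by (induction g rule: factor_induct) auto
qed (simp_all add: is_group P Q centralizer_P centralizer_Q)

lemma P_carrier: "x \<in> P \<Longrightarrow> x \<in> carrier G" using subgroup.mem_carrier[OF P] .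

lemma Q_carrier: "x \<in> Q \<Longrightarrow> x \<in> carrier G" using subgroup.mem_carrier[OF Q] .

text \<open>Take the cocycle that is the identity on \<open>P\<close> and trivial on
  \<open>Q\<close> in every state. Its values do not depend on the state, so the cocycle law turns
  into multiplicativity.\<close>

lemma retraction:
  obtains r where "r \<in> hom G G" "\<And>x. x \<in> P \<Longrightarrow> r x = x" "\<And>x. x \<in> Q \<Longrightarrow> r x = \<one>"
    "\<And>g. g \<in> carrier G \<Longrightarrow> r g \<in> P"
proof -
  have "cocycle_on G P (\<lambda>s x. x)" "cocycle_on G Q (\<lambda>s x. \<one>)"
    using P_carrier by (auto simp: cocycle_on_def)
  then obtain c where c: "cocycle_on G (carrier G) c"
    and cP: "\<And>s x. s \<in> carrier G \<Longrightarrow> x \<in> P \<Longrightarrow> c s x = x"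
    and cQ: "\<And>s x. s \<in> carrier G \<Longrightarrow> x \<in> Q \<Longrightarrow> c s x = \<one>"
    using cocycle_extension by blast
  have *: "(\<forall>s\<in>carrier G. c s g = c \<one> g) \<and> c \<one> g \<in> P" if "g \<in> carrier G" for g
    using that
  proof (induction g rule: factor_induct)
    case one
    then show ?case using cocycle_one[OF c subgroup_self] subgroup.one_closed[OF P] by simp
  next
    case (mult x g)
    have x: "x \<in> carrier G" using mult P_carrier Q_carrier by auto
    have "c s (x \<otimes> g) = c \<one> x \<otimes> c \<one> g" if "s \<in> carrier G" for s
    proof -
      have "c s (x \<otimes> g) = c s x \<otimes> c (s \<otimes> x) g" using cocycle_onD(2)[OF c that x mult(2)] .
      moreover have "c (s \<otimes> x) g = c \<one> g" using mult(3) m_closed[OF that x] by blast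
      moreover have "c s x = c \<one> x" using mult(1) cP cQ that by auto
      ultimately show ?thesis by simp
    qed
    moreover have "c \<one> x \<in> P" using mult(1) cP cQ subgroup.one_closed[OF P] by auto
    moreover have "c \<one> g \<in> P" using mult(3) by blast
    ultimately show ?case using subgroup.m_closed[OF P] by simp
  qed
  show ?thesis
  proof (rule that[of "c \<one>"])
    have "c \<one> (x \<otimes> y) = c \<one> x \<otimes> c \<one> y" if "x \<in> carrier G" "y \<in> carrier G" for x y
      using cocycle_onD(2)[OF c one_closed that] *[OF that(2)] that(1) by (metis l_one)
    then show "c \<one> \<in> hom G G"
      using cocycle_onD(1)[OF c one_closed] by (auto simp: hom_def)
    show "c \<one> g \<in> P" if "g \<in> carrier G" for g using *[OF that] by blast
  qed (simp_all add: cP cQ)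
qed

section \<open>The twisting cocycle and its automorphism of the preimage of
  \<open>P0\<close>\<close>

context
  fixes P0 a b r u and T :: "'a set"
  assumes P0: "subgroup P0 G" and a: "a \<in> P" "a \<notin> P0" and b: "b \<in> Q"
    and r_hom: "r \<in> hom G G" and r_P: "\<And>x. x \<in> P \<Longrightarrow> r x = x"
    and r_Q: "\<And>x. x \<in> Q \<Longrightarrow> r x = \<one>"
    and T_def: "T = {s \<in> carrier G. r s \<in> P0 #> a}" and u_def: "u = inv a \<otimes> b \<otimes> a"
begin

interpretation r: group_hom G G r
  using r_hom by unfold_locales

private lemma carrs: "a \<in> carrier G" "b \<in> carrier G" "u \<in> carrier G" "P0 \<subseteq> carrier G"
  using a b P_carrier Q_carrier subgroup.subset[OF P0] by (auto simp: u_def)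

private lemma r_u: "r u = \<one>"
  using carrs a b r_Q by (simp add: u_def)

private lemma T_cong:
  assumes "s \<in> carrier G" "t \<in> carrier G" "r s \<otimes> inv (r t) \<in> P0"
  shows "s \<in> T \<longleftrightarrow> t \<in> T"
proof -
  have "P0 #> r s = P0 #> r t"
  proof -
    have "r s = (r s \<otimes> inv (r t)) \<otimes> r t" using assms by (simp add: m_assoc)
    then have "r s \<in> P0 #> r t" using assms(3) unfolding r_coset_def by blast
    then show ?thesis using repr_independence[OF _ _ P0] assms by simp
  qed
  then show ?thesis unfolding T_def
    using assms(1,2) carrs repr_independence[OF _ _ P0] rcos_self[OF _ P0] by (metis (lifting) mem_Collect_eq r.hom_closed)
qed

text \<open>Seen through \<open>r\<close>, translation by \<open>a^-1\<close> carries the coset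
  \<open>P0 a\<close> to \<open>P0\<close>, and these are disjoint because
  \<open>a \<notin> P0\<close>.\<close>

private lemma T_shift: "s \<in> T \<Longrightarrow> s \<otimes> inv a \<in> carrier G \<and> s \<otimes> inv a \<notin> T"
proof -
  assume "s \<in> T"
  then obtain h where s: "s \<in> carrier G" "h \<in> P0" "r s = h \<otimes> a" by (auto simp: T_def r_coset_def)
  have h: "h \<in> carrier G" using s carrs by auto
  have rs: "r (s \<otimes> inv a) = h" using s h carrs r_P[OF a(1)] by (simp add: m_assoc)
  have "h \<notin> P0 #> a"
  proof
    assume "h \<in> P0 #> a"
    then obtain k where k: "k \<in> P0" "h = k \<otimes> a" by (auto simp: r_coset_def)
    then have "a = inv k \<otimes> h" using carrs by (auto simp: inv_mult_cancel)
    then show False using a(2) k(1) s(2) subgroup.m_closed[OF P0] subgroup.m_inv_closed[OF P0] by simp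
  qed
  then show ?thesis using rs s carrs by (simp add: T_def)
qed

private lemma one_notin_T: "\<one> \<notin> T"
proof
  assume "\<one> \<in> T"
  then obtain k where k: "k \<in> P0" "\<one> = k \<otimes> a" by (auto simp: T_def r_coset_def)
  then have "a = inv k" using carrs by (metis inv_equality inv_inv subsetD inv_closed)
  then show False using a(2) k(1) subgroup.m_inv_closed[OF P0] by simp
qed

text \<open>\<open>T\<close> is the right coset \<open>H a\<close> of the preimage \<open>H\<close>
  of \<open>P0\<close> under \<open>r\<close>. For \<open>v = u\<close> and
  \<open>y \<in> Q\<close>, reading \<open>a y a^-1\<close> from the state \<open>\<one>\<close>
  yields \<open>a u y u^-1 a^-1 = b a y a^-1 b^-1\<close>, because \<open>a u = b a\<close>; so
  \<open>c \<one>\<close> is the map \<open>\<phi>\<close> of the introduction. The parameter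
  \<open>v\<close> is there to cover the inverse, where \<open>v = inv u\<close>.\<close>

definition twist :: "'a \<Rightarrow> ('a \<Rightarrow> 'a \<Rightarrow> 'a) \<Rightarrow> bool" where
  "twist v c \<longleftrightarrow> cocycle_on G (carrier G) c \<and> (\<forall>s\<in>carrier G. (\<forall>x\<in>P. c s x = x) \<and>
     (\<forall>x\<in>Q. c s x = (if s \<in> T then v \<otimes> x \<otimes> inv v else x)))"

private lemma twist_exists:
  assumes v: "v \<in> carrier G"
  shows "\<exists>c. twist v c"
proof -
  have "cocycle_on G P (\<lambda>s x. x)" using P_carrier by (auto simp: cocycle_on_def)
  moreover have "cocycle_on G Q (\<lambda>s x. if s \<in> T then v \<otimes> x \<otimes> inv v else x)"
  proof -
    \<comment> \<open>Letters from \<open>Q\<close> do not change the membership of the state in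
      \<open>T\<close>, so in each state the prescription is a homomorphism on
      \<open>Q\<close>.\<close>
    have "s \<otimes> x \<in> T \<longleftrightarrow> s \<in> T" if "s \<in> carrier G" "x \<in> Q" for s x
      using that Q_carrier r_Q subgroup.one_closed[OF P0] by (intro T_cong) auto
    then show ?thesis using v Q_carrier by (auto simp: cocycle_on_def m_assoc inv_mult_cancel)
  qed
  ultimately show ?thesis using cocycle_extension unfolding twist_def by blast
qed

private lemma twistD:
  assumes "twist v c" "s \<in> carrier G"
  shows "g \<in> carrier G \<Longrightarrow> c s g \<in> carrier G"
    and "g \<in> carrier G \<Longrightarrow> h \<in> carrier G \<Longrightarrow> c s (g \<otimes> h) = c s g \<otimes> c (s \<otimes> g) h"
    and "c s \<one> = \<one>"
    and "g \<in> carrier G \<Longrightarrow> c s (inv g) = inv (c (s \<otimes> inv g) g)"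
    and "x \<in> P \<Longrightarrow> c s x = x"
    and "x \<in> Q \<Longrightarrow> s \<in> T \<Longrightarrow> c s x = v \<otimes> x \<otimes> inv v"
    and "x \<in> Q \<Longrightarrow> s \<notin> T \<Longrightarrow> c s x = x"
  using assms cocycle_onD[of G "carrier G" c] cocycle_one[of "carrier G" c, OF _ subgroup_self]
    cocycle_inv unfolding twist_def by auto

text \<open>The prescription depends on the state only through membership in \<open>T\<close>, hence
  through the coset of \<open>r s\<close> modulo \<open>P0\<close>, and reading a letter keeps equal
  cosets equal. For \<open>x\<close> in the preimage of \<open>P0\<close> it follows that
  \<open>c x\<close> and \<open>c \<one>\<close> agree, which makes \<open>c \<one>\<close>
  multiplicative there.\<close>

private lemma twist_state:
  assumes c: "twist v c" and g: "g \<in> carrier G"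
    and st: "s \<in> carrier G" "t \<in> carrier G" "r s \<otimes> inv (r t) \<in> P0"
  shows "c s g = c t g"
  using g st
proof (induction g arbitrary: s t rule: factor_induct)
  case one
  then show ?case using twistD(3)[OF c] by simp
next
  case (mult x g)
  have x: "x \<in> carrier G" using mult(1) P_carrier Q_carrier by auto
  have "r (s \<otimes> x) \<otimes> inv (r (t \<otimes> x)) \<in> P0"
    using mult x by (simp add: inv_mult_group m_assoc inv_mult_cancel)
  then have "c (s \<otimes> x) g = c (t \<otimes> x) g" using mult x by simp
  moreover have "c s x = c t x"
    using mult(1) T_cong[OF mult(4-6)] twistD(5-7)[OF c] mult(4,5) by (cases "s \<in> T") auto
  ultimately show ?case using twistD(2)[OF c] mult x by simp
qed

text \<open>Each letter is output unchanged or, if it is in \<open>Q\<close>, conjugated by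
  \<open>v\<close>, and \<open>r\<close> kills \<open>Q\<close>. Consequently the twist preserves
  the preimage of \<open>P0\<close>.\<close>

private lemma twist_r:
  assumes c: "twist v c" and v: "v \<in> carrier G" "r v = \<one>" and g: "g \<in> carrier G"
    and s: "s \<in> carrier G"
  shows "r (c s g) = r g"
  using g s
proof (induction g arbitrary: s rule: factor_induct)
  case one
  then show ?case using twistD(3)[OF c] by simp
next
  case (mult x g)
  have x: "x \<in> carrier G" using mult(1) P_carrier Q_carrier by auto
  have "r (c s x) = r x"
    using mult(1,4) twistD(5-7)[OF c mult(4)] r_Q v Q_carrier by (cases "s \<in> T") auto
  then show ?case using twistD(1,2)[OF c] mult x by simp
qed

text \<open>Read \<open>u = a^-1 b a\<close> from a state in \<open>T\<close>: the letter
  \<open>a^-1\<close> leads out of \<open>T\<close>, there \<open>b\<close> is output unchanged, and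
  letters of \<open>P\<close> are never changed. So \<open>u\<close> survives the twist by any
  \<open>v\<close>.\<close>

private lemma twist_u:
  assumes c: "twist v c" and s: "s \<in> T"
  shows "c s u = u" "c s (inv u) = inv u"
proof -
  have *: "c s u = u" if s: "s \<in> T" for s
  proof -
    have sc: "s \<in> carrier G" using s by (simp add: T_def)
    have sa: "s \<otimes> inv a \<in> carrier G" "s \<otimes> inv a \<notin> T" using T_shift[OF s] by auto
    have "c s u = c s (inv a) \<otimes> c (s \<otimes> inv a) b \<otimes> c (s \<otimes> (inv a \<otimes> b)) a"
      unfolding u_def using sc carrs twistD(2)[OF c] by simp
    also have "c s (inv a) = inv a"
      using twistD(5)[OF c sc] subgroup.m_inv_closed[OF P a(1)] by simp
    also have "c (s \<otimes> inv a) b = b" using twistD(7)[OF c sa(1) b sa(2)] .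
    also have "c (s \<otimes> (inv a \<otimes> b)) a = a" using twistD(5)[OF c _ a(1)] sc carrs by simp
    finally show ?thesis by (simp add: u_def)
  qed
  show "c s u = u" using *[OF s] .
  have sc: "s \<in> carrier G" using s by (simp add: T_def)
  have "s \<otimes> inv u \<in> T \<longleftrightarrow> s \<in> T"
    using sc carrs r_u subgroup.one_closed[OF P0] by (intro T_cong) auto
  then show "c s (inv u) = inv u" using twistD(4)[OF c sc carrs(3)] * s by simp
qed

text \<open>On a letter \<open>x\<close> of \<open>Q\<close> in a state of \<open>T\<close>,
  \<open>c\<close> outputs \<open>v x v^-1\<close>. As \<open>v\<close> is \<open>u\<close> or its
  inverse, \<open>c'\<close> reads \<open>v\<close> and \<open>v^-1\<close> without change and turns
  \<open>x\<close> into \<open>v^-1 x v\<close>, so the conjugations cancel.\<close>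

private lemma twist_inverse:
  assumes v: "v = u \<or> v = inv u" and c: "twist v c" and c': "twist (inv v) c'"
    and g: "g \<in> carrier G" and s: "s \<in> carrier G"
  shows "c' s (c s g) = g"
  using g s
proof (induction g arbitrary: s rule: factor_induct)
  case one
  then show ?case using twistD(3)[OF c] twistD(3)[OF c'] by simp
next
  case (mult x g)
  have vc: "v \<in> carrier G" "r v = \<one>" using v carrs r_u by auto
  have x: "x \<in> carrier G" using mult(1) P_carrier Q_carrier by auto
  have cx: "c s x \<in> carrier G" using twistD(1)[OF c] mult x by simp
  have cg: "c (s \<otimes> x) g \<in> carrier G" using twistD(1)[OF c] mult x by simp
  \<comment> \<open>After the output \<open>c s x\<close> the second cocycle is in the state
    \<open>s \<otimes> c s x\<close> instead of \<open>s \<otimes> x\<close>, but \<open>r\<close>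
    does not distinguish the two.\<close>
  have "c' (s \<otimes> c s x) (c (s \<otimes> x) g) = c' (s \<otimes> x) (c (s \<otimes> x) g)"
    using twist_r[OF c vc x mult(4)] mult(4) x cx subgroup.one_closed[OF P0]
    by (intro twist_state[OF c' cg]) auto
  also have "\<dots> = g" using mult x by simp
  finally have 1: "c' (s \<otimes> c s x) (c (s \<otimes> x) g) = g" .
  have 2: "c' s (c s x) = x"
  proof (cases "x \<in> Q \<and> s \<in> T")
    case True
    then have sT: "s \<in> T" and xQ: "x \<in> Q" by auto
    have c'v: "c' t v = v" "c' t (inv v) = inv v" if "t \<in> T" for t
      using v twist_u[OF c' that] carrs by auto
    \<comment> \<open>Both \<open>v\<close> and \<open>x\<close> are killed by \<open>r\<close>, so
      the intermediate states stay in \<open>T\<close>.\<close>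
    have "s \<otimes> v \<in> T" "s \<otimes> (v \<otimes> x) \<in> T"
      using T_cong[of "s \<otimes> v" s] T_cong[of "s \<otimes> (v \<otimes> x)" s] sT mult(4) vc x r_Q[OF xQ]
        subgroup.one_closed[OF P0] by auto
    then have "c' s (v \<otimes> x \<otimes> inv v) = v \<otimes> (inv v \<otimes> x \<otimes> v) \<otimes> inv v"
      using twistD(2)[OF c'] twistD(6)[OF c' _ xQ] c'v sT vc x mult(4) by simp
    then show ?thesis using twistD(6)[OF c mult(4) xQ sT] vc x by (simp add: m_assoc inv_mult_cancel)
  next
    case False
    then show ?thesis using twistD(5,7)[OF c mult(4)] twistD(5,7)[OF c' mult(4)] mult(1) by fastforce
  qed
  show ?case using twistD(2)[OF c mult(4) x mult(2)] twistD(2)[OF c' mult(4) cx cg] 1 2 by simp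
qed

private lemma twist_partial_comm:
  assumes c: "twist u c" and H_def: "H = {g \<in> carrier G. r g \<in> P0}"
    and fi: "fi_subgroup (G\<lparr>carrier := P\<rparr>) P0" and r_range: "\<And>g. g \<in> carrier G \<Longrightarrow> r g \<in> P"
  shows "(H, restrict (c \<one>) H) \<in> partial_comms G"
proof -
  obtain c' where c': "twist (inv u) c'" using twist_exists carrs by blast
  \<comment> \<open>Seen this way, \<open>c\<close> is also the inverse twist of \<open>c'\<close>,
    so the inversion lemma applies in both directions and \<open>c \<one>\<close> is a bijection of
    \<open>H\<close>.\<close>
  have c'': "twist (inv (inv u)) c" using c carrs by simp
  have r_hom_P: "r \<in> hom G (G\<lparr>carrier := P\<rparr>)"
    using r_range by (auto simp: hom_def)
  have fiH: "fi_subgroup G H"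
    unfolding H_def
    by (rule fi_subgroup_vimage[OF is_group subgroup.subgroup_is_group[OF P is_group] r_hom_P fi])
  have inv1: "c' \<one> (c \<one> g) = g" "c \<one> (c' \<one> g) = g" if "g \<in> H" for g
    using twist_inverse[OF _ c c', of g \<one>] twist_inverse[OF _ c' c'', of g \<one>] that
    by (simp_all add: H_def)
  have in_H: "c \<one> g \<in> H" "c' \<one> g \<in> H" if "g \<in> H" for g
    using that twistD(1)[OF c one_closed] twistD(1)[OF c' one_closed] carrs r_u
      twist_r[OF c, of g \<one>] twist_r[OF c', of g \<one>] by (simp_all add: H_def)
  have im: "restrict (c \<one>) H ` H = H"
  proof
    show "restrict (c \<one>) H ` H \<subseteq> H" using in_H by auto
    show "H \<subseteq> restrict (c \<one>) H ` H"
    proof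
      fix g assume "g \<in> H"
      then show "g \<in> restrict (c \<one>) H ` H"
        using inv1(2) in_H(2) by (intro image_eqI[of _ _ "c' \<one> g"]) auto
    qed
  qed
  show ?thesis
  proof (rule partial_commsI)
    show "fi_subgroup G (restrict (c \<one>) H ` H)" unfolding im by (rule fiH)
    show "inj_on (restrict (c \<one>) H) H"
      by (rule inj_on_inverseI[where g = "c' \<one>"]) (simp add: inv1)
    fix x y assume xy: "x \<in> H" "y \<in> H"
    then have xyc: "x \<in> carrier G" "y \<in> carrier G" "r x \<in> P0" by (auto simp: H_def)
    have "x \<otimes> y \<in> H" using xy fiH subgroup.m_closed by (fastforce simp: fi_subgroup_def)
    moreover have "c x y = c \<one> y" using xyc by (intro twist_state[OF c]) auto
    ultimately show "restrict (c \<one>) H (x \<otimes> y) = restrict (c \<one>) H x \<otimes> restrict (c \<one>) H y"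
      using xy xyc twistD(2)[OF c one_closed xyc(1,2)] by simp
  qed (use fiH in auto)
qed

text \<open>The witness is \<open>c \<one>\<close> on the preimage \<open>H\<close> of
  \<open>P0\<close>. If an equivalent \<open>f\<close> had \<open>a^m\<close> in its domain with
  \<open>p\<close> not dividing \<open>m\<close>, it would be defined at some
  \<open>d \<in> T\<close>. Its value \<open>e\<close> there would have to conjugate powers of
  \<open>a\<close> as \<open>d\<close> does and powers of \<open>b\<close> as \<open>d u\<close>
  does, and no \<open>e\<close> can do both.\<close>

lemma twist_obstruction:
  fixes p :: nat
  assumes p: "Factorial_Ring.prime p" and a_pow: "\<And>m::nat. p dvd m \<Longrightarrow> a [^] m \<in> P0"
    and fi: "fi_subgroup (G\<lparr>carrier := P\<rparr>) P0" and r_range: "\<And>g. g \<in> carrier G \<Longrightarrow> r g \<in> P"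
    and tf: "\<And>n::nat. n > 0 \<Longrightarrow> a [^] n \<noteq> \<one> \<and> b [^] n \<noteq> \<one>"
  shows "\<exists>\<alpha>\<in>partial_comms G. \<forall>\<beta>\<in>partial_comms G. comm_equiv G \<alpha> \<beta> \<longrightarrow>
       (\<forall>m::nat. a [^] m \<in> fst \<beta> \<longrightarrow> p dvd m)"
proof -
  obtain c where c: "twist u c" using twist_exists carrs by blast
  define H where "H = {g \<in> carrier G. r g \<in> P0}"
  note \<alpha> = twist_partial_comm[OF c H_def fi r_range]
  have "p dvd m" if \<beta>: "(D, f) \<in> partial_comms G"
    and eqv: "comm_equiv G (H, restrict (c \<one>) H) (D, f)" and am: "a [^] m \<in> D" for D f and m :: nat
  proof (rule ccontr)
    assume "\<not> p dvd m"
    then have cop: "gcd m p = 1" and m0: "m \<noteq> 0"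
      using p prime_imp_coprime[of p m] by (metis coprime_iff_gcd_eq_1 gcd.commute, metis dvd_0_right)
    \<comment> \<open>The exponent \<open>m m' = p k + 1\<close> gives a power of \<open>a^m\<close>
      that lies in the coset \<open>P0 a\<close>.\<close>
    obtain m' k where mk: "m * m' = p * k + 1" using bezout_nat[OF m0, of p] cop by auto
    define d where "d = a [^] (m * m')"
    have D: "d \<in> D" unfolding d_def
      using partial_comms_pow(2)[OF \<beta> am, of m'] carrs by (simp add: nat_pow_pow)
    have dP: "d \<in> P"
      unfolding d_def by (rule subgroup_pow_closed[OF P a(1)])
    have dc: "d \<in> carrier G" using dP P_carrier by simp
    have "d = a [^] (p * k) \<otimes> a" unfolding d_def mk using carrs by simp
    then have dT: "d \<in> T"
      using a_pow[of "p * k"] dc r_P[OF dP] by (auto simp: T_def r_coset_def)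
    define e where "e = f d"
    have ec: "e \<in> carrier G" using partial_commsD(8)[OF \<beta> D] by (simp add: e_def)
    interpret f: group_hom "G\<lparr>carrier := D\<rparr>" G f using partial_commsD(10)[OF \<beta>] .
    obtain K where K: "fi_subgroup G K" "K \<subseteq> H \<inter> D" "\<And>x. x \<in> K \<Longrightarrow> c \<one> x = f x"
      using eqv unfolding comm_equiv_def by (fastforce simp: subset_iff)
    have sK: "subgroup K G" using K by (simp add: fi_subgroup_def)
    note Kpow = subgroup_pow_closed[OF sK]
    \<comment> \<open>\<open>f\<close> is known to agree with \<open>c \<one>\<close> only on
      \<open>K\<close>, and \<open>d\<close> lies outside \<open>K\<close>. A common exponent
      \<open>i * j\<close> brings both the power of \<open>x\<close> and its conjugate by
      \<open>d\<close> into \<open>K\<close>, while \<open>f\<close> is multiplicative on all of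
      \<open>D\<close>.\<close>
    have key: "\<exists>n>0. c \<one> (d \<otimes> x [^] n \<otimes> inv d) = e \<otimes> c \<one> (x [^] (n::nat)) \<otimes> inv e"
      if x: "x \<in> carrier G" for x
    proof -
      obtain i j :: nat where ij: "i > 0" "x [^] i \<in> K" "j > 0" "(d \<otimes> x \<otimes> inv d) [^] j \<in> K"
        using fi_subgroup_pow[OF K(1)] x dc by (meson inv_closed m_closed)
      have 1: "x [^] (i * j) \<in> K" using Kpow[OF ij(2), of j] x by (simp add: nat_pow_pow)
      have 2: "d \<otimes> x [^] (i * j) \<otimes> inv d \<in> K"
        using Kpow[OF ij(4), of i] x dc by (simp add: nat_pow_pow conj_pow mult.commute)
      have xD: "x [^] (i * j) \<in> D" using 1 K(2) by blast
      have "f (d \<otimes> x [^] (i * j) \<otimes> inv d) = e \<otimes> f (x [^] (i * j)) \<otimes> inv e"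
        using f.hom_mult[of "d \<otimes> x [^] (i * j)" "inv\<^bsub>G\<lparr>carrier := D\<rparr>\<^esub> d"] f.hom_mult[of d "x [^] (i * j)"]
          f.hom_inv[of d] D xD f.m_closed[of d "x [^] (i * j)"] f.G.inv_closed[of d]
          m_inv_consistent[OF partial_commsD(6)[OF \<beta>] D] by (simp add: e_def)
      then show ?thesis using K(3)[OF 1] K(3)[OF 2] ij by (intro exI[of _ "i * j"]) simp
    qed
    note pow_P = subgroup_pow_closed[OF P a(1)] and pow_Q = subgroup_pow_closed[OF Q b]
    \<comment> \<open>Powers of \<open>a\<close> and their conjugates by \<open>d\<close> lie in
      \<open>P\<close>, where \<open>c \<one>\<close> is the identity; so
      \<open>inv e \<otimes> d\<close> centralizes a nontrivial power of \<open>a\<close>.\<close>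
    have eP: "inv e \<otimes> d \<in> P"
    proof -
      obtain n :: nat where n: "n > 0" "c \<one> (d \<otimes> a [^] n \<otimes> inv d) = e \<otimes> c \<one> (a [^] n) \<otimes> inv e"
        using key carrs by blast
      have "d \<otimes> a [^] n \<otimes> inv d \<in> P"
        using dP pow_P subgroup.m_closed[OF P] subgroup.m_inv_closed[OF P] by simp
      then have "d \<otimes> a [^] n \<otimes> inv d = e \<otimes> a [^] n \<otimes> inv e"
        using n(2) twistD(5)[OF c one_closed] pow_P by simp
      note comm = conj_commute[OF dc ec P_carrier[OF pow_P] this]
      show ?thesis
        by (rule centralizer_P[OF pow_P _ _ comm]) (use dc ec tf[OF n(1)] in simp_all)
    qed
    \<comment> \<open>In the state \<open>d\<close>, which is in \<open>T\<close>, the letter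
      \<open>b^n\<close> is conjugated by \<open>u\<close>; in the state \<open>\<one>\<close> it is
      unchanged. Hence \<open>d u\<close> and \<open>e\<close> conjugate \<open>b^n\<close>
      alike.\<close>
    have gQ: "inv e \<otimes> (d \<otimes> u) \<in> Q"
    proof -
      obtain n :: nat where n: "n > 0" "c \<one> (d \<otimes> b [^] n \<otimes> inv d) = e \<otimes> c \<one> (b [^] n) \<otimes> inv e"
        using key carrs by blast
      let ?y = "b [^] n"
      have y: "?y \<in> carrier G" using carrs by simp
      have "c \<one> (d \<otimes> ?y \<otimes> inv d) = c \<one> d \<otimes> c d ?y \<otimes> c (d \<otimes> ?y) (inv d)"
        using twistD(2)[OF c one_closed] dc y by simp
      also have "\<dots> = d \<otimes> (u \<otimes> ?y \<otimes> inv u) \<otimes> inv d"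
        using twistD(5)[OF c] twistD(6)[OF c dc pow_Q dT] dP dc y subgroup.m_inv_closed[OF P dP] by simp
      also have "\<dots> = (d \<otimes> u) \<otimes> ?y \<otimes> inv (d \<otimes> u)"
        using dc carrs y by (simp add: m_assoc inv_mult_group)
      finally have "(d \<otimes> u) \<otimes> ?y \<otimes> inv (d \<otimes> u) = e \<otimes> ?y \<otimes> inv e"
        using n(2) twistD(7)[OF c one_closed pow_Q one_notin_T] by simp
      note comm = conj_commute[OF m_closed[OF dc carrs(3)] ec y this]
      show ?thesis
        by (rule centralizer_Q[OF pow_Q _ _ comm]) (use dc ec carrs(3) tf[OF n(1)] in simp_all)
    qed
    \<comment> \<open>Compute \<open>r (inv e \<otimes> d \<otimes> u)\<close> twice: it is
      \<open>\<one>\<close> since the argument is in \<open>Q\<close>, and it is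
      \<open>inv e \<otimes> d\<close> since this is in \<open>P\<close> and
      \<open>r u = \<one>\<close>.\<close>
    have "inv e \<otimes> d = \<one>"
    proof -
      have "\<one> = r ((inv e \<otimes> d) \<otimes> u)" using r_Q[OF gQ] dc ec carrs by (simp add: m_assoc)
      also have "\<dots> = r (inv e \<otimes> d)" using r.hom_mult[of "inv e \<otimes> d" u] r_u dc ec carrs by simp
      also have "\<dots> = inv e \<otimes> d" by (rule r_P[OF eP])
      finally show ?thesis by simp
    qed
    then have uQ: "u \<in> Q" using gQ dc ec carrs by (simp add: m_assoc[symmetric])
    \<comment> \<open>The retraction onto \<open>Q\<close> kills \<open>a\<close> and so sends
      \<open>u = a^-1 b a\<close> to \<open>b\<close>. As \<open>u\<close> is in \<open>Q\<close>,
      this gives \<open>u = b\<close>, and \<open>a\<close> commutes with \<open>b\<close>.\<close>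
    obtain q where q: "q \<in> hom G G" "\<And>x. x \<in> Q \<Longrightarrow> q x = x" "\<And>x. x \<in> P \<Longrightarrow> q x = \<one>"
      using internal_free_product.retraction[OF swap] by metis
    interpret q: group_hom G G q using q(1) by unfold_locales
    have "u = b" using q(2)[OF uQ] q(2)[OF b] q(3)[OF a(1)] carrs by (simp add: u_def)
    then have "a \<otimes> b = a \<otimes> (inv a \<otimes> b \<otimes> a)" by (simp add: u_def)
    also have "\<dots> = b \<otimes> a" using carrs by (simp add: m_assoc inv_mult_cancel)
    finally have "a \<in> Q" using centralizer_Q[OF b _ carrs(1)] tf[of 1] carrs by simp
    \<comment> \<open>\<open>r\<close> is the identity on \<open>P\<close> and trivial on
      \<open>Q\<close>, so the two factors meet trivially.\<close>
    then have "a = \<one>" using r_Q r_P a(1) by metis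
    then show False using a(2) subgroup.one_closed[OF P0] by simp
  qed
  then show ?thesis using \<alpha> by (intro bexI[OF _ \<alpha>]) auto
qed

end

theorem obstruction:
  fixes p :: nat
  assumes "subgroup P0 G" "a \<in> P" "a \<notin> P0" "Factorial_Ring.prime p" "\<And>m::nat. p dvd m \<Longrightarrow> a [^] m \<in> P0"
    and "fi_subgroup (G\<lparr>carrier := P\<rparr>) P0"
    and "b \<in> Q" "\<And>n::nat. n > 0 \<Longrightarrow> a [^] n \<noteq> \<one> \<and> b [^] n \<noteq> \<one>"
  shows "\<exists>\<alpha>\<in>partial_comms G. \<forall>\<beta>\<in>partial_comms G. comm_equiv G \<alpha> \<beta> \<longrightarrow>
       (\<exists>x\<in>carrier G. \<forall>m::nat. x [^] m \<in> fst \<beta> \<longrightarrow> p dvd m)"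
proof -
  obtain r where r: "r \<in> hom G G" "\<And>x. x \<in> P \<Longrightarrow> r x = x" "\<And>x. x \<in> Q \<Longrightarrow> r x = \<one>"
    "\<And>g. g \<in> carrier G \<Longrightarrow> r g \<in> P" using retraction by metis
  show ?thesis
    using twist_obstruction[OF assms(1-3,7) r(1-3) refl refl assms(4-6) r(4) assms(8)] P_carrier[OF assms(2)]
    by blast
qed

end

section \<open>Reduced words\<close>

lemma fp_alternating_Cons:
  "fp_alternating (x # w) \<longleftrightarrow> (w = [] \<or> isl x \<noteq> isl (hd w)) \<and> fp_alternating w"
  by (cases w) auto

text \<open>The equations are the multiplication tables of the factors, which are the defining
  relations of the free product; a word acts by \<open>foldr f\<close>. The notion is applied to
  reduced words, for associativity, and to functions on the group, for extending cocycles.\<close>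

definition letter_action :: "('a, 'c) monoid_scheme \<Rightarrow> ('b, 'd) monoid_scheme \<Rightarrow>
    ('a + 'b \<Rightarrow> 'x \<Rightarrow> 'x) \<Rightarrow> 'x set \<Rightarrow> bool" where
  "letter_action A B f Y \<longleftrightarrow>
     (\<forall>l. \<forall>x\<in>Y. fp_letter A B l \<longrightarrow> f l x \<in> Y) \<and>
     (\<forall>a a'. \<forall>x\<in>Y. fp_letter A B (Inl a) \<longrightarrow> fp_letter A B (Inl a') \<longrightarrow>
        f (Inl a) (f (Inl a') x) = (if a \<otimes>\<^bsub>A\<^esub> a' = \<one>\<^bsub>A\<^esub> then x else f (Inl (a \<otimes>\<^bsub>A\<^esub> a')) x)) \<and>
     (\<forall>b b'. \<forall>x\<in>Y. fp_letter A B (Inr b) \<longrightarrow> fp_letter A B (Inr b') \<longrightarrow>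
        f (Inr b) (f (Inr b') x) = (if b \<otimes>\<^bsub>B\<^esub> b' = \<one>\<^bsub>B\<^esub> then x else f (Inr (b \<otimes>\<^bsub>B\<^esub> b')) x))"

locale free_product_pair = A: group A + B: group B
  for A :: "('a, 'c) monoid_scheme" and B :: "('b, 'd) monoid_scheme"
begin

abbreviation FP where "FP \<equiv> free_product A B"

lemma carrier_FP: "w \<in> carrier FP \<longleftrightarrow> (\<forall>x\<in>set w. fp_letter A B x) \<and> fp_alternating w"
  by (simp add: free_product_def)

lemma mult_FP: "u \<otimes>\<^bsub>FP\<^esub> v = foldr (fp_push A B) u v"
  by (simp add: free_product_def)

lemma one_FP: "\<one>\<^bsub>FP\<^esub> = []"
  by (simp add: free_product_def)

lemma letter_Inl: "fp_letter A B (Inl a) \<longleftrightarrow> a \<in> carrier A \<and> a \<noteq> \<one>\<^bsub>A\<^esub>"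
  and letter_Inr: "fp_letter A B (Inr b) \<longleftrightarrow> b \<in> carrier B \<and> b \<noteq> \<one>\<^bsub>B\<^esub>"
  by (simp_all add: fp_letter_def)

lemma push_letters:
  assumes "fp_letter A B l" "\<forall>x\<in>set w. fp_letter A B x"
  shows "\<forall>x\<in>set (fp_push A B l w). fp_letter A B x"
proof (cases w)
  case (Cons x v)
  then show ?thesis using assms by (cases l; cases x) (auto simp: letter_Inl letter_Inr)
qed (use assms in \<open>cases l; simp\<close>)

lemma push_alternating: "fp_alternating w \<Longrightarrow> fp_alternating (fp_push A B l w)"
  by (induction A B l w rule: fp_push.induct) (auto simp: fp_alternating_Cons)

lemma push_closed: "fp_letter A B l \<Longrightarrow> w \<in> carrier FP \<Longrightarrow> fp_push A B l w \<in> carrier FP"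
  using push_letters[of l w] push_alternating[of w l] by (simp add: carrier_FP)

lemma push_neq: "w = [] \<or> isl l \<noteq> isl (hd w) \<Longrightarrow> fp_push A B l w = l # w"
  by (induction A B l w rule: fp_push.induct) auto

lemma letter_action_closed:
  assumes "letter_action A B f Y" "x \<in> Y" "\<forall>l\<in>set w. fp_letter A B l"
  shows "foldr f w x \<in> Y"
  using assms by (induction w) (auto simp: letter_action_def)

text \<open>\<open>fp_push\<close> merges or cancels two letters of one factor exactly as the
  relations in \<open>letter_action\<close> do.\<close>

lemma letter_action_push:
  assumes "letter_action A B f Y" "x \<in> Y" "\<forall>l\<in>set w. fp_letter A B l" "fp_letter A B l"
  shows "foldr f (fp_push A B l w) x = f l (foldr f w x)"
proof (cases "w = [] \<or> isl l \<noteq> isl (hd w)")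
  case True
  then show ?thesis by (simp add: push_neq)
next
  case False
  then obtain l' w' where w: "w = l' # w'" "isl l = isl l'" by (cases w) auto
  have Y: "foldr f w' x \<in> Y" using assms w by (intro letter_action_closed) auto
  show ?thesis
  proof (cases l)
    case (Inl a)
    then obtain a' where "l' = Inl a'" using w by (cases l') auto
    then show ?thesis using Inl w Y assms by (auto simp: letter_action_def)
  next
    case (Inr b)
    then obtain b' where "l' = Inr b'" using w by (cases l') auto
    then show ?thesis using Inr w Y assms by (auto simp: letter_action_def)
  qed
qed

text \<open>A product arises by pushing the letters of \<open>u\<close> onto \<open>v\<close> one
  after another, and each push acts as its letter.\<close>

lemma letter_action_mult:
  assumes "letter_action A B f Y" "x \<in> Y" "u \<in> carrier FP" "v \<in> carrier FP"
  shows "foldr f (u \<otimes>\<^bsub>FP\<^esub> v) x = foldr f u (foldr f v x)"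
proof -
  have letters: "\<forall>l\<in>set (foldr (fp_push A B) u v). fp_letter A B l"
    if "\<forall>l\<in>set u. fp_letter A B l" "\<forall>l\<in>set v. fp_letter A B l" for u
    using that(1)
  proof (induction u)
    case (Cons l u)
    then have "fp_letter A B l" "\<forall>x\<in>set (foldr (fp_push A B) u v). fp_letter A B x" by simp_all
    from push_letters[OF this] show ?case by simp
  qed (use that(2) in simp)
  have "foldr f (foldr (fp_push A B) u v) x = foldr f u (foldr f v x)"
    if "\<forall>l\<in>set u. fp_letter A B l" "\<forall>l\<in>set v. fp_letter A B l"
    using that(1)
  proof (induction u)
    case (Cons l u)
    then have l: "fp_letter A B l" and u: "\<forall>l\<in>set u. fp_letter A B l" by simp_all
    show ?case
      using letter_action_push[OF assms(1,2) letters[OF u that(2)] l] Cons.IH[OF u] by simp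
  qed simp
  then show ?thesis using assms(3,4) by (simp add: carrier_FP mult_FP)
qed

text \<open>Van der Waerden's argument: each factor acts on the set of reduced words. The
  cancellations are checked here, and associativity then follows formally.\<close>

lemma push_action: "letter_action A B (fp_push A B) (carrier FP)"
proof -
  have "fp_push A B (Inl a) (fp_push A B (Inl a') w)
      = (if a \<otimes>\<^bsub>A\<^esub> a' = \<one>\<^bsub>A\<^esub> then w else fp_push A B (Inl (a \<otimes>\<^bsub>A\<^esub> a')) w)"
    if w: "w \<in> carrier FP" and l: "fp_letter A B (Inl a)" "fp_letter A B (Inl a')" for a a' w
  proof (cases "w = [] \<or> \<not> isl (hd w)")
    case True
    then show ?thesis by (simp add: push_neq)
  next
    case False
    then obtain x w' where x: "w = Inl x # w'" by (cases w; cases "hd w") auto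
    have w': "w' = [] \<or> \<not> isl (hd w')" using w x by (auto simp: carrier_FP fp_alternating_Cons)
    have c: "a \<in> carrier A" "a' \<in> carrier A" "x \<in> carrier A" "x \<noteq> \<one>\<^bsub>A\<^esub>" "a \<noteq> \<one>\<^bsub>A\<^esub>"
      using w l x by (auto simp: carrier_FP letter_Inl)
    have assoc: "a \<otimes>\<^bsub>A\<^esub> (a' \<otimes>\<^bsub>A\<^esub> x) = (a \<otimes>\<^bsub>A\<^esub> a') \<otimes>\<^bsub>A\<^esub> x" using c by (simp add: A.m_assoc)
    show ?thesis
    proof (cases "a' \<otimes>\<^bsub>A\<^esub> x = \<one>\<^bsub>A\<^esub>")
      case True
      \<comment> \<open>If \<open>a'\<close> cancels the head \<open>x\<close>, pushing
        \<open>a\<close> onto the tail merely prepends it, and \<open>a a' x = a\<close> yields the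
        same word on the other side.\<close>
      then have "(a \<otimes>\<^bsub>A\<^esub> a') \<otimes>\<^bsub>A\<^esub> x = a" using assoc c by simp
      then show ?thesis using x w' True c by (auto simp: push_neq)
    next
      case False
      then show ?thesis using x assoc c by auto
    qed
  qed
  moreover have "fp_push A B (Inr a) (fp_push A B (Inr a') w)
      = (if a \<otimes>\<^bsub>B\<^esub> a' = \<one>\<^bsub>B\<^esub> then w else fp_push A B (Inr (a \<otimes>\<^bsub>B\<^esub> a')) w)"
    if w: "w \<in> carrier FP" and l: "fp_letter A B (Inr a)" "fp_letter A B (Inr a')" for a a' w
  proof (cases "w = [] \<or> isl (hd w)")
    case True
    then show ?thesis by (simp add: push_neq)
  next
    case False
    then obtain x w' where x: "w = Inr x # w'" by (cases w; cases "hd w") auto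
    have w': "w' = [] \<or> isl (hd w')" using w x by (auto simp: carrier_FP fp_alternating_Cons)
    have c: "a \<in> carrier B" "a' \<in> carrier B" "x \<in> carrier B" "x \<noteq> \<one>\<^bsub>B\<^esub>" "a \<noteq> \<one>\<^bsub>B\<^esub>"
      using w l x by (auto simp: carrier_FP letter_Inr)
    have assoc: "a \<otimes>\<^bsub>B\<^esub> (a' \<otimes>\<^bsub>B\<^esub> x) = (a \<otimes>\<^bsub>B\<^esub> a') \<otimes>\<^bsub>B\<^esub> x" using c by (simp add: B.m_assoc)
    show ?thesis
    proof (cases "a' \<otimes>\<^bsub>B\<^esub> x = \<one>\<^bsub>B\<^esub>")
      case True
      then have "(a \<otimes>\<^bsub>B\<^esub> a') \<otimes>\<^bsub>B\<^esub> x = a" using assoc c by simp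
      then show ?thesis using x w' True c by (auto simp: push_neq)
    next
      case False
      then show ?thesis using x assoc c by auto
    qed
  qed
  ultimately show ?thesis unfolding letter_action_def using push_closed by blast
qed

lemma Cons_eq_mult: "l # w \<in> carrier FP \<Longrightarrow> l # w = [l] \<otimes>\<^bsub>FP\<^esub> w"
  by (auto simp: mult_FP carrier_FP fp_alternating_Cons push_neq)

lemma Cons_carrierD: "l # w \<in> carrier FP \<Longrightarrow> fp_letter A B l \<and> w \<in> carrier FP"
  by (auto simp: carrier_FP fp_alternating_Cons)

lemma letter_carrier: "[l] \<in> carrier FP \<longleftrightarrow> fp_letter A B l"
  by (simp add: carrier_FP)

section \<open>The embedded factors and the group structure\<close>

definition emb_A :: "'a \<Rightarrow> ('a + 'b) list" where "emb_A a = (if a = \<one>\<^bsub>A\<^esub> then [] else [Inl a])"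

definition emb_B :: "'b \<Rightarrow> ('a + 'b) list" where "emb_B b = (if b = \<one>\<^bsub>B\<^esub> then [] else [Inr b])"

lemma emb_A_hom: "emb_A \<in> hom A FP"
  by (auto simp: hom_def emb_A_def mult_FP carrier_FP letter_Inl)

lemma emb_B_hom: "emb_B \<in> hom B FP"
  by (auto simp: hom_def emb_B_def mult_FP carrier_FP letter_Inr)

lemma emb_A_inj: "inj_on emb_A (carrier A)" by (auto simp: inj_on_def emb_A_def)

lemma emb_B_inj: "inj_on emb_B (carrier B)" by (auto simp: inj_on_def emb_B_def)

lemma group_FP: "group FP"
proof (rule groupI)
  show mc: "x \<otimes>\<^bsub>FP\<^esub> y \<in> carrier FP" if "x \<in> carrier FP" "y \<in> carrier FP" for x y
    unfolding mult_FP by (rule letter_action_closed[OF push_action that(2)]) (use that(1) in \<open>simp add: carrier_FP\<close>)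
  \<comment> \<open>Associativity is the action law for pushing, applied to the word
    \<open>z\<close>.\<close>
  show assoc: "x \<otimes>\<^bsub>FP\<^esub> y \<otimes>\<^bsub>FP\<^esub> z = x \<otimes>\<^bsub>FP\<^esub> (y \<otimes>\<^bsub>FP\<^esub> z)"
    if "x \<in> carrier FP" "y \<in> carrier FP" "z \<in> carrier FP" for x y z
    using letter_action_mult[OF push_action that(3,1,2)] by (simp add: mult_FP)
  show "\<one>\<^bsub>FP\<^esub> \<in> carrier FP" by (simp add: one_FP carrier_FP)
  show one: "\<one>\<^bsub>FP\<^esub> \<otimes>\<^bsub>FP\<^esub> x = x" if "x \<in> carrier FP" for x by (simp add: one_FP mult_FP)
  show "\<exists>y\<in>carrier FP. y \<otimes>\<^bsub>FP\<^esub> x = \<one>\<^bsub>FP\<^esub>" if "x \<in> carrier FP" for x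
    using that
  proof (induction x)
    case Nil
    then show ?case by (intro bexI[of _ "[]"]) (auto simp: one_FP mult_FP)
  next
    case (Cons l w)
    have lw: "fp_letter A B l" "w \<in> carrier FP" using Cons_carrierD[OF Cons.prems] by auto
    obtain y where y: "y \<in> carrier FP" "y \<otimes>\<^bsub>FP\<^esub> w = \<one>\<^bsub>FP\<^esub>" using Cons.IH lw by blast
    obtain l' where l': "[l'] \<in> carrier FP" "[l'] \<otimes>\<^bsub>FP\<^esub> [l] = \<one>\<^bsub>FP\<^esub>"
    proof (cases l)
      case (Inl a)
      then show ?thesis using that[of "Inl (inv\<^bsub>A\<^esub> a)"] lw by (simp add: letter_carrier letter_Inl one_FP mult_FP)
    next
      case (Inr b)
      then show ?thesis using that[of "Inr (inv\<^bsub>B\<^esub> b)"] lw by (simp add: letter_carrier letter_Inr one_FP mult_FP)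
    qed
    have l: "[l] \<in> carrier FP" using lw(1) by (simp add: letter_carrier)
    have lw': "l # w \<in> carrier FP" by (rule Cons.prems)
    have "[l'] \<otimes>\<^bsub>FP\<^esub> (l # w) = w"
      using assoc[OF l'(1) l lw(2)] l'(2) one[OF lw(2)] Cons_eq_mult[OF lw'] by metis
    then have "(y \<otimes>\<^bsub>FP\<^esub> [l']) \<otimes>\<^bsub>FP\<^esub> (l # w) = \<one>\<^bsub>FP\<^esub>"
      using assoc[OF y(1) l'(1) lw'] y(2) by metis
    then show ?case using mc[OF y(1) l'(1)] by blast
  qed
qed

sublocale FP: group FP
  by (rule group_FP)

text \<open>Letters act on functions \<open>k\<close> by sending \<open>k\<close> to the function
  with value \<open>LM s l \<otimes> k (s \<otimes> [l])\<close> at \<open>s\<close>; the cocycle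
  laws of \<open>L\<close> and \<open>M\<close> make this a letter action. Then \<open>c s g\<close>
  is the value at \<open>s\<close> of the word \<open>g\<close> applied to the constant function
  \<open>\<one>\<close>.\<close>

lemma cocycle_extension_FP:
  assumes L: "cocycle_on FP (emb_A ` carrier A) L" and M: "cocycle_on FP (emb_B ` carrier B) M"
  shows "\<exists>c. cocycle_on FP (carrier FP) c \<and>
    (\<forall>s\<in>carrier FP. (\<forall>x\<in>emb_A ` carrier A. c s x = L s x) \<and> (\<forall>x\<in>emb_B ` carrier B. c s x = M s x))"
proof -
  interpret eA: group_hom A FP emb_A using emb_A_hom by unfold_locales
  interpret eB: group_hom B FP emb_B using emb_B_hom by unfold_locales
  let ?C = "carrier FP"
  define LM where "LM s l = (if isl l then L s [l] else M s [l])" for s l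
  \<comment> \<open>\<open>restrict\<close> turns agreement on the carrier into equality of
    functions, in which \<open>letter_action\<close> is phrased.\<close>
  define F where "F l k = restrict (\<lambda>s. LM s l \<otimes>\<^bsub>FP\<^esub> k (s \<otimes>\<^bsub>FP\<^esub> [l])) ?C" for l k
  define e where "e = restrict (\<lambda>s. \<one>\<^bsub>FP\<^esub>) ?C"
  define c where "c s g = foldr F g e s" for s g
  have L1: "L s [] = []" and M1: "M s [] = []" if "s \<in> ?C" for s
    using FP.cocycle_one[OF L eA.img_is_subgroup that] FP.cocycle_one[OF M eB.img_is_subgroup that]
    by (simp_all add: one_FP)
  have inA: "[Inl a] \<in> emb_A ` carrier A" if "fp_letter A B (Inl a)" for a
    using that by (intro image_eqI[of _ _ a]) (auto simp: emb_A_def letter_Inl)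
  have inB: "[Inr b] \<in> emb_B ` carrier B" if "fp_letter A B (Inr b)" for b
    using that by (intro image_eqI[of _ _ b]) (auto simp: emb_B_def letter_Inr)
  have LMc: "LM s l \<in> ?C" if "s \<in> ?C" "fp_letter A B l" for s l
    using cocycle_onD(1)[OF L that(1)] cocycle_onD(1)[OF M that(1)] inA inB that(2)
    by (cases l) (auto simp: LM_def)
  have FC: "F l k \<in> ?C \<rightarrow>\<^sub>E ?C" if "k \<in> ?C \<rightarrow>\<^sub>E ?C" "fp_letter A B l" for l k
    using that LMc unfolding F_def by (auto simp: letter_carrier PiE_iff)
  have FF: "F l (F l' k) = restrict (\<lambda>s. (LM s l \<otimes>\<^bsub>FP\<^esub> LM (s \<otimes>\<^bsub>FP\<^esub> [l]) l') \<otimes>\<^bsub>FP\<^esub> k (s \<otimes>\<^bsub>FP\<^esub> ([l] \<otimes>\<^bsub>FP\<^esub> [l']))) ?C"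
    if k: "k \<in> ?C \<rightarrow>\<^sub>E ?C" and l: "fp_letter A B l" "fp_letter A B l'" for l l' k
  proof
    fix s
    have kc: "k s \<in> ?C" if "s \<in> ?C" for s using k that by auto
    show "F l (F l' k) s = restrict (\<lambda>s. (LM s l \<otimes>\<^bsub>FP\<^esub> LM (s \<otimes>\<^bsub>FP\<^esub> [l]) l') \<otimes>\<^bsub>FP\<^esub> k (s \<otimes>\<^bsub>FP\<^esub> ([l] \<otimes>\<^bsub>FP\<^esub> [l']))) ?C s"
      using l LMc kc by (simp add: F_def letter_carrier FP.m_assoc)
  qed
  \<comment> \<open>This covers two letters that cancel each other.\<close>
  have k1: "restrict (\<lambda>s. \<one>\<^bsub>FP\<^esub> \<otimes>\<^bsub>FP\<^esub> k (s \<otimes>\<^bsub>FP\<^esub> \<one>\<^bsub>FP\<^esub>)) ?C = k" if k: "k \<in> ?C \<rightarrow>\<^sub>E ?C" for k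
  proof
    fix s
    show "restrict (\<lambda>s. \<one>\<^bsub>FP\<^esub> \<otimes>\<^bsub>FP\<^esub> k (s \<otimes>\<^bsub>FP\<^esub> \<one>\<^bsub>FP\<^esub>)) ?C s = k s"
    proof (cases "s \<in> ?C")
      case True
      moreover have "k s \<in> ?C" using k True by auto
      ultimately show ?thesis by simp
    next
      case False
      then show ?thesis using PiE_arb[OF k] by simp
    qed
  qed
  have act: "letter_action A B F (?C \<rightarrow>\<^sub>E ?C)"
    unfolding letter_action_def
  proof (intro conjI allI ballI impI)
    fix a a' k assume k: "k \<in> ?C \<rightarrow>\<^sub>E ?C" and l: "fp_letter A B (Inl a)" "fp_letter A B (Inl a')"
    have m: "[Inl a] \<otimes>\<^bsub>FP\<^esub> [Inl a'] = (if a \<otimes>\<^bsub>A\<^esub> a' = \<one>\<^bsub>A\<^esub> then \<one>\<^bsub>FP\<^esub> else [Inl (a \<otimes>\<^bsub>A\<^esub> a')])"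
      by (simp add: mult_FP one_FP)
    have "LM s (Inl a) \<otimes>\<^bsub>FP\<^esub> LM (s \<otimes>\<^bsub>FP\<^esub> [Inl a]) (Inl a')
        = (if a \<otimes>\<^bsub>A\<^esub> a' = \<one>\<^bsub>A\<^esub> then \<one>\<^bsub>FP\<^esub> else LM s (Inl (a \<otimes>\<^bsub>A\<^esub> a')))" if s: "s \<in> ?C" for s
      using cocycle_onD(2)[OF L s inA[OF l(1)] inA[OF l(2)]] L1[OF s] unfolding m
      by (auto simp: LM_def one_FP)
    then show "F (Inl a) (F (Inl a') k) = (if a \<otimes>\<^bsub>A\<^esub> a' = \<one>\<^bsub>A\<^esub> then k else F (Inl (a \<otimes>\<^bsub>A\<^esub> a')) k)"
      unfolding FF[OF k l] m using k1[OF k] by (auto simp: F_def cong: restrict_cong)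
  next
    fix a a' k assume k: "k \<in> ?C \<rightarrow>\<^sub>E ?C" and l: "fp_letter A B (Inr a)" "fp_letter A B (Inr a')"
    have m: "[Inr a] \<otimes>\<^bsub>FP\<^esub> [Inr a'] = (if a \<otimes>\<^bsub>B\<^esub> a' = \<one>\<^bsub>B\<^esub> then \<one>\<^bsub>FP\<^esub> else [Inr (a \<otimes>\<^bsub>B\<^esub> a')])"
      by (simp add: mult_FP one_FP)
    have "LM s (Inr a) \<otimes>\<^bsub>FP\<^esub> LM (s \<otimes>\<^bsub>FP\<^esub> [Inr a]) (Inr a')
        = (if a \<otimes>\<^bsub>B\<^esub> a' = \<one>\<^bsub>B\<^esub> then \<one>\<^bsub>FP\<^esub> else LM s (Inr (a \<otimes>\<^bsub>B\<^esub> a')))" if s: "s \<in> ?C" for s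
      using cocycle_onD(2)[OF M s inB[OF l(1)] inB[OF l(2)]] M1[OF s] unfolding m
      by (auto simp: LM_def one_FP)
    then show "F (Inr a) (F (Inr a') k) = (if a \<otimes>\<^bsub>B\<^esub> a' = \<one>\<^bsub>B\<^esub> then k else F (Inr (a \<otimes>\<^bsub>B\<^esub> a')) k)"
      unfolding FF[OF k l] m using k1[OF k] by (auto simp: F_def cong: restrict_cong)
  qed (use FC in blast)
  have e: "e \<in> ?C \<rightarrow>\<^sub>E ?C" by (auto simp: e_def)
  have foldc: "foldr F g k \<in> ?C \<rightarrow>\<^sub>E ?C" if "k \<in> ?C \<rightarrow>\<^sub>E ?C" "g \<in> ?C" for g k
    using letter_action_closed[OF act that(1)] that(2) by (simp add: carrier_FP)
  have cc: "c s g \<in> ?C" if "s \<in> ?C" "g \<in> ?C" for s g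
    using foldc[OF e that(2)] that(1) by (auto simp: c_def)
  \<comment> \<open>Acting on \<open>k\<close> instead of the constant function adds the factor
    \<open>k (s \<otimes> g)\<close>. With \<open>k\<close> obtained from a second word
    \<open>h\<close> this becomes the cocycle law.\<close>
  have fold: "foldr F g k s = c s g \<otimes>\<^bsub>FP\<^esub> k (s \<otimes>\<^bsub>FP\<^esub> g)"
    if "k \<in> ?C \<rightarrow>\<^sub>E ?C" "s \<in> ?C" "g \<in> ?C" for k s g
    using that(2,3)
  proof (induction g arbitrary: s)
    case Nil
    have "c s [] = \<one>\<^bsub>FP\<^esub>" using Nil(1) by (simp add: c_def e_def)
    moreover have "s \<otimes>\<^bsub>FP\<^esub> [] = s" using FP.r_one[OF Nil(1)] by (simp only: one_FP)
    ultimately show ?case using FP.l_one[OF PiE_mem[OF that(1) Nil(1)]] by (simp only: foldr.simps id_apply)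
  next
    case (Cons l g)
    have lg: "fp_letter A B l" "[l] \<in> ?C" "g \<in> ?C"
      using Cons_carrierD[OF Cons.prems(2)] by (auto simp: letter_carrier)
    have sl: "s \<otimes>\<^bsub>FP\<^esub> [l] \<in> ?C" using lg Cons.prems(1) by simp
    have kc: "k (s \<otimes>\<^bsub>FP\<^esub> [l] \<otimes>\<^bsub>FP\<^esub> g) \<in> ?C" using PiE_mem[OF that(1)] sl lg by simp
    have "c s (l # g) = LM s l \<otimes>\<^bsub>FP\<^esub> c (s \<otimes>\<^bsub>FP\<^esub> [l]) g"
      using Cons.prems(1) by (simp add: c_def F_def)
    moreover have "foldr F (l # g) k s = LM s l \<otimes>\<^bsub>FP\<^esub> foldr F g k (s \<otimes>\<^bsub>FP\<^esub> [l])"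
      using Cons.prems(1) by (simp add: F_def)
    moreover have "s \<otimes>\<^bsub>FP\<^esub> (l # g) = s \<otimes>\<^bsub>FP\<^esub> [l] \<otimes>\<^bsub>FP\<^esub> g"
      using Cons_eq_mult[OF Cons.prems(2)] lg Cons.prems(1) by (simp add: FP.m_assoc)
    ultimately show ?case
      using Cons.IH[OF sl lg(3)] LMc[OF Cons.prems(1) lg(1)] cc[OF sl lg(3)] kc
      by (simp add: FP.m_assoc)
  qed
  have coc: "cocycle_on FP ?C c"
    unfolding cocycle_on_def
  proof (intro ballI conjI)
    fix s g h assume *: "s \<in> ?C" "g \<in> ?C" "h \<in> ?C"
    show "c s (g \<otimes>\<^bsub>FP\<^esub> h) = c s g \<otimes>\<^bsub>FP\<^esub> c (s \<otimes>\<^bsub>FP\<^esub> g) h"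
      using letter_action_mult[OF act e *(2,3)] fold[OF foldc[OF e *(3)] *(1,2)] by (simp add: c_def)
  qed (use cc in blast)
  have c_Nil: "c s [] = []" if "s \<in> ?C" for s
    using that by (simp add: c_def e_def one_FP)
  have c_letter: "c s [l] = LM s l" if "s \<in> ?C" "fp_letter A B l" for s l
  proof -
    have "s \<otimes>\<^bsub>FP\<^esub> [l] \<in> ?C" using that letter_carrier by blast
    then have "c s [l] = LM s l \<otimes>\<^bsub>FP\<^esub> \<one>\<^bsub>FP\<^esub>" using that(1) by (simp add: c_def e_def F_def)
    then show ?thesis using LMc[OF that] by simp
  qed
  have cL: "c s x = L s x" if s: "s \<in> ?C" and x: "x \<in> emb_A ` carrier A" for s x
  proof (cases "x = []")
    case False
    then obtain a where "x = [Inl a]" "fp_letter A B (Inl a)"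
      using x by (auto simp: emb_A_def letter_Inl split: if_splits)
    then show ?thesis using c_letter[OF s] by (simp add: LM_def)
  qed (simp add: c_Nil L1 s)
  have cM: "c s x = M s x" if s: "s \<in> ?C" and x: "x \<in> emb_B ` carrier B" for s x
  proof (cases "x = []")
    case False
    then obtain b where "x = [Inr b]" "fp_letter A B (Inr b)"
      using x by (auto simp: emb_B_def letter_Inr split: if_splits)
    then show ?thesis using c_letter[OF s] by (simp add: LM_def)
  qed (simp add: c_Nil M1 s)
  show ?thesis by (intro exI[of _ c] conjI ballI coc cL cM)
qed

section \<open>Centralizers of letters\<close>

lemma mult_letter_side:
  assumes "w \<in> carrier FP" "w \<noteq> []"
  shows "w \<otimes>\<^bsub>FP\<^esub> [l] = [] \<or> isl (hd (w \<otimes>\<^bsub>FP\<^esub> [l])) = isl (hd w)"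
  using assms
proof (induction w)
  case (Cons x w)
  show ?case
  proof (cases "w = []")
    case True
    then show ?thesis by (cases x; cases l) (auto simp: mult_FP)
  next
    case False
    have "w \<in> carrier FP" "isl x \<noteq> isl (hd w)"
      using Cons.prems False by (auto simp: carrier_FP fp_alternating_Cons)
    then have "fp_push A B x (w \<otimes>\<^bsub>FP\<^esub> [l]) = x # (w \<otimes>\<^bsub>FP\<^esub> [l])"
      using Cons.IH False by (intro push_neq) auto
    then show ?thesis by (simp add: mult_FP)
  qed
qed simp

text \<open>Multiplying the tail \<open>w\<close> by a letter on the right either empties it or
  keeps the factor of its first letter, so \<open>x\<close> never meets a letter of its own
  factor.\<close>

lemma mult_letter_hd:
  assumes "x # w \<in> carrier FP" "w \<noteq> []"
  shows "(x # w) \<otimes>\<^bsub>FP\<^esub> [l] = x # (w \<otimes>\<^bsub>FP\<^esub> [l])"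
proof -
  have "w \<in> carrier FP" "isl x \<noteq> isl (hd w)"
    using assms by (auto simp: carrier_FP fp_alternating_Cons)
  then have "fp_push A B x (w \<otimes>\<^bsub>FP\<^esub> [l]) = x # (w \<otimes>\<^bsub>FP\<^esub> [l])"
    using mult_letter_side[of w l] assms(2) by (intro push_neq) auto
  then show ?thesis by (simp add: mult_FP)
qed

text \<open>Compare first letters. If \<open>g\<close> starts in the other factor,
  \<open>[l] g\<close> starts with \<open>l\<close> but \<open>g [l]\<close> does not. If
  \<open>g\<close> starts in the factor of \<open>l\<close> and has at least two letters,
  \<open>g [l]\<close> keeps its first letter \<open>x\<close>, whereas in \<open>[l] g\<close> it
  is changed by a nontrivial factor or cancelled, which exposes a letter of the other
  factor.\<close>

lemma letter_centralizer:
  assumes l: "fp_letter A B l" and g: "g \<in> carrier FP" and comm: "g \<otimes>\<^bsub>FP\<^esub> [l] = [l] \<otimes>\<^bsub>FP\<^esub> g"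
  shows "g = [] \<or> (\<exists>l'. g = [l'] \<and> isl l' = isl l)"
proof (cases g)
  case (Cons x w)
  have pushed: "[l] \<otimes>\<^bsub>FP\<^esub> g = fp_push A B l g" by (simp add: mult_FP)
  show ?thesis
  proof (cases "isl x = isl l")
    case False
    then have 1: "[l] \<otimes>\<^bsub>FP\<^esub> g = l # g" unfolding pushed using Cons by (intro push_neq) auto
    have "\<exists>z. g \<otimes>\<^bsub>FP\<^esub> [l] = x # z"
    proof (cases "w = []")
      case True
      then show ?thesis using Cons False by (simp add: mult_FP push_neq)
    next
      case False
      then show ?thesis using mult_letter_hd g Cons by blast
    qed
    then show ?thesis using 1 comm False by auto
  next
    case True
    show ?thesis
    proof (cases "w = []")
      case True
      then show ?thesis using Cons \<open>isl x = isl l\<close> by simp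
    next
      case w: False
      have z: "fp_push A B l (x # w) = x # (w \<otimes>\<^bsub>FP\<^esub> [l])"
        using mult_letter_hd[of x w l] w g Cons comm pushed by simp
      have x: "fp_letter A B x" "isl x \<noteq> isl (hd w)"
        using g Cons w by (auto simp: carrier_FP fp_alternating_Cons)
      show ?thesis
      proof (cases l)
        case (Inl a)
        then obtain a' where a': "x = Inl a'" using True by (cases x) auto
        show ?thesis
        proof (cases "a \<otimes>\<^bsub>A\<^esub> a' = \<one>\<^bsub>A\<^esub>")
          case True
          then have "w = x # (w \<otimes>\<^bsub>FP\<^esub> [l])" using z a' Inl by simp
          then have "hd w = x" by (metis list.sel(1))
          then show ?thesis using x by simp
        next
          case False
          then have "a \<otimes>\<^bsub>A\<^esub> a' = a'" using z a' Inl by simp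
          then show ?thesis using x l a' Inl by (simp add: letter_Inl)
        qed
      next
        case (Inr a)
        then obtain a' where a': "x = Inr a'" using True by (cases x) auto
        show ?thesis
        proof (cases "a \<otimes>\<^bsub>B\<^esub> a' = \<one>\<^bsub>B\<^esub>")
          case True
          then have "w = x # (w \<otimes>\<^bsub>FP\<^esub> [l])" using z a' Inr by simp
          then have "hd w = x" by (metis list.sel(1))
          then show ?thesis using x by simp
        next
          case False
          then have "a \<otimes>\<^bsub>B\<^esub> a' = a'" using z a' Inr by simp
          then show ?thesis using x l a' Inr by (simp add: letter_Inr)
        qed
      qed
    qed
  qed
qed simp

theorem internal_free_product_FP:
  "internal_free_product FP (emb_A ` carrier A) (emb_B ` carrier B)"
proof (intro internal_free_product.intro internal_free_product_axioms.intro)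
  interpret eA: group_hom A FP emb_A using emb_A_hom by unfold_locales
  interpret eB: group_hom B FP emb_B using emb_B_hom by unfold_locales
  show "subgroup (emb_A ` carrier A) FP" by (rule eA.img_is_subgroup)
  show "subgroup (emb_B ` carrier B) FP" by (rule eB.img_is_subgroup)
  show "group FP" by (rule group_FP)
next
  fix g and R :: "('a + 'b) list \<Rightarrow> bool"
  assume "g \<in> carrier FP" and 1: "R \<one>\<^bsub>FP\<^esub>"
    and step: "\<And>x g. x \<in> emb_A ` carrier A \<union> emb_B ` carrier B \<Longrightarrow> g \<in> carrier FP \<Longrightarrow> R g \<Longrightarrow> R (x \<otimes>\<^bsub>FP\<^esub> g)"
  then show "R g"
  proof (induction g)
    case Nil
    then show ?case by (simp add: one_FP)
  next
    case (Cons l w)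
    have lw: "fp_letter A B l" "w \<in> carrier FP" using Cons_carrierD[OF Cons.prems(1)] by auto
    have "[l] \<in> emb_A ` carrier A \<union> emb_B ` carrier B"
    proof (cases l)
      case (Inl a)
      then show ?thesis using lw(1) by (auto simp: emb_A_def letter_Inl image_iff)
    next
      case (Inr b)
      then show ?thesis using lw(1) by (auto simp: emb_B_def letter_Inr image_iff)
    qed
    then have "R ([l] \<otimes>\<^bsub>FP\<^esub> w)" using step lw(2) Cons.IH[OF lw(2) 1 step] by blast
    then show ?case using Cons_eq_mult[OF Cons.prems(1)] by simp
  qed
next
  fix L M assume "cocycle_on FP (emb_A ` carrier A) L" "cocycle_on FP (emb_B ` carrier B) M"
  then show "\<exists>c. cocycle_on FP (carrier FP) c \<and>
    (\<forall>s\<in>carrier FP. (\<forall>x\<in>emb_A ` carrier A. c s x = L s x) \<and> (\<forall>x\<in>emb_B ` carrier B. c s x = M s x))"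
    by (rule cocycle_extension_FP)
next
  fix x g assume x: "x \<in> emb_A ` carrier A" "x \<noteq> \<one>\<^bsub>FP\<^esub>" and g: "g \<in> carrier FP"
    and comm: "g \<otimes>\<^bsub>FP\<^esub> x = x \<otimes>\<^bsub>FP\<^esub> g"
  obtain a where a: "x = [Inl a]" "fp_letter A B (Inl a)"
    using x by (auto simp: emb_A_def one_FP letter_Inl split: if_splits)
  have "g = [] \<or> (\<exists>y. g = [Inl y])"
    using letter_centralizer[OF a(2) g] comm a(1) by (auto simp: isl_def)
  then show "g \<in> emb_A ` carrier A"
    using g A.one_closed by (auto simp: emb_A_def letter_carrier letter_Inl image_iff)
next
  fix x g assume x: "x \<in> emb_B ` carrier B" "x \<noteq> \<one>\<^bsub>FP\<^esub>" and g: "g \<in> carrier FP"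
    and comm: "g \<otimes>\<^bsub>FP\<^esub> x = x \<otimes>\<^bsub>FP\<^esub> g"
  obtain b where b: "x = [Inr b]" "fp_letter A B (Inr b)"
    using x by (auto simp: emb_B_def one_FP letter_Inr split: if_splits)
  have "g = [] \<or> (\<exists>y. g = [Inr y])"
    using letter_centralizer[OF b(2) g] comm b(1) by (metis sum.collapse(2) sum.disc(2))
  then show "g \<in> emb_B ` carrier B"
    using g B.one_closed by (auto simp: emb_B_def letter_carrier letter_Inr image_iff)
qed

end

section \<open>Large prime quotients\<close>

text \<open>Torsion-freeness, from comparison with the root \<open>\<one>\<close> of
  \<open>\<one>\<close>; it keeps the powers of \<open>a\<close> and \<open>b\<close> in the
  centralizer argument nontrivial.\<close>

lemma (in group) unique_roots_pow_neq_one: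
  assumes "unique_roots G" "x \<in> carrier G" "x \<noteq> \<one>" "(n::nat) > 0"
  shows "x [^] n \<noteq> \<one>"
proof
  assume "x [^] n = \<one>"
  then have "x [^] n = \<one> [^] n" by simp
  then show False using assms unfolding unique_roots_def by blast
qed

text \<open>The quotient has more than one element, so some \<open>a\<close> lies outside
  \<open>H\<close>; by Lagrange the coset of \<open>a\<close> has trivial \<open>p\<close>-th
  power.\<close>

lemma prime_quotient_element:
  assumes H: "H \<lhd> G" and p: "order (G Mod H) = p" "Factorial_Ring.prime p"
  shows "\<exists>a\<in>carrier G - H. \<forall>m::nat. p dvd m \<longrightarrow> a [^]\<^bsub>G\<^esub> m \<in> H"
proof -
  interpret normal H G by (rule H)
  interpret GH: group "G Mod H" by (rule factorgroup_is_group)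
  interpret proj: group_hom G "G Mod H" "\<lambda>a. H #>\<^bsub>G\<^esub> a"
    using r_coset_hom_Mod by unfold_locales
  have sH: "subgroup H G" by unfold_locales
  have coset: "x \<in> H" if "x \<in> carrier G" "H #>\<^bsub>G\<^esub> x = H" for x
    using rcos_self[OF that(1) sH] that(2) by simp
  have "\<not> carrier G \<subseteq> H"
  proof
    assume "carrier G \<subseteq> H"
    then have "carrier (G Mod H) \<subseteq> {H}"
      using coset_join2[OF _ sH] by (auto simp: FactGroup_def RCOSETS_def)
    then have "order (G Mod H) \<le> 1"
      unfolding order_def using card_mono[of "{H}" "carrier (G Mod H)"] by simp
    then show False using p prime_gt_1_nat[of p] by simp
  qed
  then obtain a where a: "a \<in> carrier G" "a \<notin> H" by blast
  have "a [^]\<^bsub>G\<^esub> m \<in> H" if p_dvd: "p dvd m" for m :: nat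
  proof -
    obtain k where m: "m = p * k" using p_dvd by blast
    have "(H #>\<^bsub>G\<^esub> a) [^]\<^bsub>G Mod H\<^esub> p = \<one>\<^bsub>G Mod H\<^esub>"
      using GH.pow_order_eq_1[of "H #>\<^bsub>G\<^esub> a"] a p(1) by simp
    then have "(H #>\<^bsub>G\<^esub> a) [^]\<^bsub>G Mod H\<^esub> m = \<one>\<^bsub>G Mod H\<^esub>"
      using GH.nat_pow_pow[of "H #>\<^bsub>G\<^esub> a" p k] GH.nat_pow_one[of k] proj.hom_closed[OF a(1)]
      by (metis m)
    then have "H #>\<^bsub>G\<^esub> (a [^]\<^bsub>G\<^esub> m) = H"
      using proj.hom_nat_pow[OF a(1)] by simp
    then show ?thesis using coset a by simp
  qed
  then show ?thesis using a by blast
qed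

text \<open>An infinite set has \<open>card\<close> 0, so a prime value of \<open>order\<close>
  forces finitely many cosets.\<close>

lemma prime_quotient_finite_index:
  assumes H: "H \<lhd> G" and p: "order (G Mod H) = p" "Factorial_Ring.prime p"
  shows "fi_subgroup G H"
proof -
  have "card (rcosets\<^bsub>G\<^esub> H) \<noteq> 0"
    using p by (auto simp: order_def FactGroup_def)
  then have "finite (rcosets\<^bsub>G\<^esub> H)" by (simp add: card_ge_0_finite)
  then show ?thesis using normal_imp_subgroup[OF H] by (simp add: fi_subgroup_def)
qed

text \<open>On the image of \<open>A\<close>, the set of images of \<open>H\<close> is the preimage
  of \<open>H\<close> under the inverse of \<open>i\<close>.\<close>

lemma fi_subgroup_image:
  assumes "group A" "group G" and i: "i \<in> hom A G" "inj_on i (carrier A)" and H: "fi_subgroup A H"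
  shows "fi_subgroup (G\<lparr>carrier := i ` carrier A\<rparr>) (i ` H)"
proof -
  interpret i: group_hom A G i using assms by (simp add: group_hom_def group_hom_axioms_def)
  let ?P = "i ` carrier A" and ?j = "inv_into (carrier A) i"
  have ji: "?j (i x) = x" if "x \<in> carrier A" for x using i(2) that by simp
  have HA: "H \<subseteq> carrier A" using H subgroup.subset by (auto simp: fi_subgroup_def)
  have grp: "group (G\<lparr>carrier := ?P\<rparr>)"
    using subgroup.subgroup_is_group[OF i.img_is_subgroup assms(2)] .
  have "?j \<in> hom (G\<lparr>carrier := ?P\<rparr>) A"
  proof (rule homI)
    fix x y assume "x \<in> carrier (G\<lparr>carrier := ?P\<rparr>)" "y \<in> carrier (G\<lparr>carrier := ?P\<rparr>)"
    then obtain x' y' where *: "x' \<in> carrier A" "x = i x'" "y' \<in> carrier A" "y = i y'" by auto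
    then have "x \<otimes>\<^bsub>G\<^esub> y = i (x' \<otimes>\<^bsub>A\<^esub> y')" by simp
    then show "?j (x \<otimes>\<^bsub>G\<lparr>carrier := ?P\<rparr>\<^esub> y) = ?j x \<otimes>\<^bsub>A\<^esub> ?j y"
      using *(1,3) ji by (simp add: *(2,4) del: i.hom_mult add: i.hom_mult[symmetric])
  qed (auto simp: ji)
  from fi_subgroup_vimage[OF grp assms(1) this H]
  have "fi_subgroup (G\<lparr>carrier := ?P\<rparr>) {x \<in> ?P. ?j x \<in> H}" by simp
  moreover have "{x \<in> ?P. ?j x \<in> H} = i ` H"
  proof (intro equalityI subsetI)
    fix x assume "x \<in> {x \<in> ?P. ?j x \<in> H}"
    then show "x \<in> i ` H" using ji by auto
  next
    fix x assume "x \<in> i ` H"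
    then show "x \<in> {x \<in> ?P. ?j x \<in> H}" using ji HA by auto
  qed
  ultimately show ?thesis by simp
qed

text \<open>The formulation by embeddings into an arbitrary \<open>G\<close> serves both orders of
  the factors; the prime quotients belong to the factor listed first.\<close>

lemma internal_free_product_Comm:
  fixes G (structure)
  assumes ifp: "internal_free_product G (i ` carrier A) (j ` carrier B)"
    and A: "group A" "unique_roots A" "large_prime_quotients A"
    and B: "group B" "unique_roots B" "nontrivial_group B"
    and i: "i \<in> hom A G" "inj_on i (carrier A)" and j: "j \<in> hom B G" "inj_on j (carrier B)"
  shows "\<not> finitely_generated_group (Comm G)"
proof -
  interpret internal_free_product G "i ` carrier A" "j ` carrier B" by (rule ifp)
  interpret A: group A by fact
  interpret B: group B by fact
  interpret i: group_hom A G i using i by unfold_locales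
  interpret j: group_hom B G j using j by unfold_locales
  obtain b where b: "b \<in> carrier B" "b \<noteq> \<one>\<^bsub>B\<^esub>"
    using B(3) B.one_closed unfolding nontrivial_group_def by blast
  show ?thesis
  proof (rule Comm_not_finitely_generated)
    fix N
    obtain p H where p: "Factorial_Ring.prime p" "p > N" and H: "H \<lhd> A" "order (A Mod H) = p"
      using A(3) unfolding large_prime_quotients_def by blast
    obtain a where a: "a \<in> carrier A" "a \<notin> H" and pow: "\<And>m::nat. p dvd m \<Longrightarrow> a [^]\<^bsub>A\<^esub> m \<in> H"
      using prime_quotient_element[OF H p(1)] by blast
    have sH: "subgroup H A" using normal_imp_subgroup[OF H(1)] .
    have HA: "H \<subseteq> carrier A" using subgroup.subset[OF sH] .
    have a1: "a \<noteq> \<one>\<^bsub>A\<^esub>" using a subgroup.one_closed[OF sH] by blast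
    have fi: "fi_subgroup (G\<lparr>carrier := i ` carrier A\<rparr>) (i ` H)"
      using fi_subgroup_image[OF A(1) is_group i prime_quotient_finite_index[OF H p(1)]] .
    have "\<exists>\<alpha>\<in>partial_comms G. \<forall>\<beta>\<in>partial_comms G. comm_equiv G \<alpha> \<beta> \<longrightarrow>
       (\<exists>x\<in>carrier G. \<forall>m::nat. x [^] m \<in> fst \<beta> \<longrightarrow> p dvd m)"
    proof (rule obstruction[where ?P0.0 = "i ` H" and a = "i a" and b = "j b"])
      show "subgroup (i ` H) G"
        using incl_subgroup[OF P] fi by (simp add: fi_subgroup_def)
      show "i a \<in> i ` carrier A" "j b \<in> j ` carrier B" using a b by auto
      show "i a \<notin> i ` H" using inj_on_image_mem_iff[OF i(2) a(1) HA] a(2) by simp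
      show "i a [^] m \<in> i ` H" if "p dvd m" for m :: nat
        using pow[OF that] i.hom_nat_pow[OF a(1)] by (metis imageI)
      show "i a [^] n \<noteq> \<one> \<and> j b [^] n \<noteq> \<one>" if "n > 0" for n :: nat
      proof -
        have "i (a [^]\<^bsub>A\<^esub> n) \<noteq> i \<one>\<^bsub>A\<^esub>"
          using A.unique_roots_pow_neq_one[OF A(2) a(1) a1 that] inj_onD[OF i(2)] a by blast
        moreover have "j (b [^]\<^bsub>B\<^esub> n) \<noteq> j \<one>\<^bsub>B\<^esub>"
          using B.unique_roots_pow_neq_one[OF B(2) b that] inj_onD[OF j(2)] b by blast
        ultimately show ?thesis using a b by (simp add: i.hom_nat_pow j.hom_nat_pow)
      qed
    qed (fact p fi)+
    then show "\<exists>p>N. Factorial_Ring.prime p \<and>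
      (\<exists>\<alpha>\<in>partial_comms G. \<forall>\<beta>\<in>partial_comms G. comm_equiv G \<alpha> \<beta> \<longrightarrow>
         (\<exists>x\<in>carrier G. \<forall>m::nat. x [^] m \<in> fst \<beta> \<longrightarrow> p dvd m))"
      using p by blast
  qed
qed

theorem theorem3p2:
  fixes A :: "('a, 'c) monoid_scheme" and B :: "('b, 'd) monoid_scheme"
  assumes "group A" and "group B"
    and "nontrivial_group A" and "nontrivial_group B"
    and "unique_roots A" and "unique_roots B"
    and "large_prime_quotients A \<or> large_prime_quotients B"
  shows "\<not> finitely_generated_group (Comm (free_product A B))"
proof -
  interpret free_product_pair A B using assms(1,2) by (rule free_product_pair.intro)
  note ifp = internal_free_product_FP
  show ?thesis
    using assms(7)
  proof
    assume "large_prime_quotients A"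
    then show ?thesis
      by (rule internal_free_product_Comm[OF ifp assms(1,5) _ assms(2,6,4) emb_A_hom emb_A_inj emb_B_hom emb_B_inj])
  next
    assume "large_prime_quotients B"
    then show ?thesis
      by (rule internal_free_product_Comm[OF internal_free_product.swap[OF ifp] assms(2,6) _ assms(1,5,3)
            emb_B_hom emb_B_inj emb_A_hom emb_A_inj])
  qed
qed

end
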